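(* Let $M>0$. There are constants $C,C_1,c>0$ depending only on $M$ such that for all positive integers $n,p,s$ with $s\le p$ and $\frac{s\log\frac{ep}{s}}{n}\le C_1$, and for any $\epsilon\in[0,1]$, $$\inf_{\hat\Sigma}\sup_{\Sigma\in\mathcal{F}_s(M)}\sup_Q\mathbb{P}_{(\epsilon,\Sigma,Q)}\left\{\|\hat\Sigma-\Sigma\|_{\rm op}^2\ge C\left(\frac{s\log\frac{ep}{s}}{n}\vee\epsilon^2\right)\right\}\ge c,$$ where the infimum is over all estimators $\hat\Sigma=\hat\Sigma(X_1,\dots,X_n)$ and $Q$ ranges over all probability distributions on $\mathbb{R}^p$.
   Context: For $\epsilon\in[0,1]$, a covariance matrix $\Sigma\in\mathbb{R}^{p\times p}$ and a probability distribution $Q$ on $\mathbb{R}^p$, $\mathbb{P}_{(\epsilon,\Sigma,Q)}=(1-\epsilon)N(0,\Sigma)+\epsilon Q$; $X_1,\dots,X_n$ are i.i.d. from it, and the same symbol denotes their joint law. For $S\subset[p]=\{1,\dots,p\}$, $\mathcal{G}(S)=\{G=(g_{ij})\in\mathbb{R}^{p\times p}:g_{ij}=0\text{ if }i\notin S\text{ or }j\notin S\}$; $\mathcal{G}(s)=\bigcup_{S\subset[p]:|S|\le s}\mathcal{G}(S)$; $\mathcal{F}_s=\{\Sigma\succeq0:\Sigma-\mathrm{diag}(\Sigma)\in\mathcal{G}(s)\}$, where $\mathrm{diag}(\Sigma)$ is the diagonal matrix with the diagonal entries of $\Sigma$; $\mathcal{F}_s(M)=\{\Sigma\in\mathcal{F}_s:s_{\max}(\Sigma)\le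 M\}$ with $s_{\max}$ the largest singular value; $M$ does not scale with $p$ or $n$. $\|\cdot\|_{\rm op}$ is the operator norm; $a\vee b=\max(a,b)$. *)

theory Defs
  imports
    "HOL-Probability.Probability"
    "Jordan_Normal_Form.Spectral_Radius"
begin

text \<open>
  The dimension \<open>p\<close> is a bound variable of the theorem, so matrices are elements of
  \<open>carrier_mat p p\<close> and points of the sample space are extensional functions on \<open>{..<p}\<close>.
  Indices run over \<open>{..<p}\<close> in place of \<open>{1..p}\<close>.
\<close>

definition euclidean_borel :: "nat \<Rightarrow> (nat \<Rightarrow> real) measure" where
  "euclidean_borel p = PiM {..<p} (\<lambda>_. borel)"

definition vec_norm2 :: "real Matrix.vec \<Rightarrow> real" where
  "vec_norm2 v = sqrt (scalar_prod v v)"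

definition op_norm :: "real Matrix.mat \<Rightarrow> real" where
  "op_norm A = (SUP v\<in>{v \<in> carrier_vec (dim_col A). vec_norm2 v \<le> 1}. vec_norm2 (A *\<^sub>v v))"

text \<open>
  The eigenvalues of \<open>A\<^sup>T A\<close> are real and nonnegative, so the real spectrum is the
  full spectrum.
\<close>

definition singular_values :: "real Matrix.mat \<Rightarrow> real set" where
  "singular_values A = sqrt ` spectrum (transpose_mat A * A)"

definition s_max :: "real Matrix.mat \<Rightarrow> real" where
  "s_max A = Max (singular_values A)"

definition psd_mats :: "nat \<Rightarrow> real Matrix.mat set" where
  "psd_mats p = {A \<in> carrier_mat p p. transpose_mat A = A \<and>
     (\<forall>v \<in> carrier_vec p. 0 \<le> scalar_prod v (A *\<^sub>v v))}"

definition psd_sqrt :: "nat \<Rightarrow> real Matrix.mat \<Rightarrow> real Matrix.mat" where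
  "psd_sqrt p A = (THE B. B \<in> psd_mats p \<and> B * B = A)"

definition G_supp :: "nat \<Rightarrow> nat set \<Rightarrow> real Matrix.mat set" where
  "G_supp p S = {G \<in> carrier_mat p p. \<forall>i<p. \<forall>j<p. i \<notin> S \<or> j \<notin> S \<longrightarrow> G $$ (i, j) = 0}"

definition G_sparse :: "nat \<Rightarrow> nat \<Rightarrow> real Matrix.mat set" where
  "G_sparse p s = (\<Union>S\<in>{S. S \<subseteq> {..<p} \<and> card S \<le> s}. G_supp p S)"

definition F_sparse :: "nat \<Rightarrow> nat \<Rightarrow> real Matrix.mat set" where
  "F_sparse p s = {\<Sigma> \<in> psd_mats p. \<Sigma> - mat_diag p (\<lambda>i. \<Sigma> $$ (i, i)) \<in> G_sparse p s}"

definition F_bounded :: "nat \<Rightarrow> nat \<Rightarrow> real \<Rightarrow> real Matrix.mat set" where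
  "F_bounded p s M = {\<Sigma> \<in> F_sparse p s. s_max \<Sigma> \<le> M}"

text \<open>
  \<open>N(0, \<Sigma>)\<close> for positive semidefinite and possibly singular \<open>\<Sigma>\<close>:
  the law of \<open>\<Sigma>\<^sup>1\<^sup>/\<^sup>2 Z\<close> for a standard Gaussian vector \<open>Z\<close>.
\<close>

definition centered_gaussian :: "nat \<Rightarrow> real Matrix.mat \<Rightarrow> (nat \<Rightarrow> real) measure" where
  "centered_gaussian p \<Sigma> =
     distr (PiM {..<p} (\<lambda>_. density lborel (\<lambda>x. ennreal (std_normal_density x))))
       (euclidean_borel p)
       (\<lambda>z. \<lambda>i\<in>{..<p}. vec_index (psd_sqrt p \<Sigma> *\<^sub>v Matrix.vec p z) i)"

definition prob_dists :: "nat \<Rightarrow> (nat \<Rightarrow> real) measure set" where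
  "prob_dists p = {Q. prob_space Q \<and> sets Q = sets (euclidean_borel p)}"

definition contaminated ::
  "nat \<Rightarrow> real \<Rightarrow> real Matrix.mat \<Rightarrow> (nat \<Rightarrow> real) measure \<Rightarrow> (nat \<Rightarrow> real) measure" where
  "contaminated p \<epsilon> \<Sigma> Q =
     measure_of (space (euclidean_borel p)) (sets (euclidean_borel p))
       (\<lambda>A. ennreal (1 - \<epsilon>) * emeasure (centered_gaussian p \<Sigma>) A + ennreal \<epsilon> * emeasure Q A)"

text \<open>The law of the i.i.d. sample; the observation \<open>X\<^sub>k\<close> is the component \<open>X k\<close> for \<open>k < n\<close>.\<close>

definition sample_law ::
  "nat \<Rightarrow> nat \<Rightarrow> real \<Rightarrow> real Matrix.mat \<Rightarrow> (nat \<Rightarrow> real) measure \<Rightarrow> (nat \<Rightarrow> nat \<Rightarrow> real) measure" where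
  "sample_law n p \<epsilon> \<Sigma> Q = PiM {..<n} (\<lambda>_. contaminated p \<epsilon> \<Sigma> Q)"

definition sample_space :: "nat \<Rightarrow> nat \<Rightarrow> (nat \<Rightarrow> nat \<Rightarrow> real) measure" where
  "sample_space n p = PiM {..<n} (\<lambda>_. euclidean_borel p)"

text \<open>
  Estimators are the measurable functions of the data with values in the real \<open>p \<times> p\<close>
  matrices. They need not be symmetric, positive semidefinite or sparse.
\<close>

definition estimators :: "nat \<Rightarrow> nat \<Rightarrow> ((nat \<Rightarrow> nat \<Rightarrow> real) \<Rightarrow> real Matrix.mat) set" where
  "estimators n p = {T. (\<forall>X \<in> space (sample_space n p). T X \<in> carrier_mat p p) \<and>
     (\<forall>i<p. \<forall>j<p. (\<lambda>X. T X $$ (i, j)) \<in> borel_measurable (sample_space n p))}"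

definition sparse_rate :: "nat \<Rightarrow> nat \<Rightarrow> nat \<Rightarrow> real" where
  "sparse_rate n p s = real s * ln (exp 1 * real p / real s) / real n"

end

theory Submission
  imports Defs
begin

text \<open>
The lower bound splits into two independent ones, for the sparse rate and for \<open>\<epsilon>\<^sup>2\<close>. Both compare
the covariance \<open>a I\<close>, \<open>a = M / 2\<close>, with rank-one perturbations \<open>a (I + \<theta> v v\<^sup>T)\<close> for a unit vector
\<open>v\<close> with at most \<open>s\<close> nonzero entries (\<open>spiked\<close>). Such a matrix is at operator norm distance
\<open>a |\<theta>|\<close> from \<open>a I\<close>, so an estimator that errs by less than \<open>a |\<theta>| / 2\<close> at one of them errs by at
least as much at the other. It remains to see that the data cannot tell them apart.

Sparse rate. Let \<open>\<theta>\<close> be a small multiple of the square root of the rate and choose \<open>v\<close> at random: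
the coordinates are cut into \<open>s\<close> blocks of length \<open>m = \<lfloor>p / s\<rfloor>\<close>, and in each block one coordinate,
chosen uniformly, receives the value \<open>1 / sqrt s\<close> or \<open>- 1 / sqrt s\<close>. By a second moment argument
(\<open>second_moment_bound\<close>) it suffices to compare the single law at \<open>a I\<close> with the mixture over
\<open>v\<close>. If the averaged likelihood ratio of the \<open>n\<close> observations has second
moment at most \<open>2\<close>, then no event has both small probability under \<open>a I\<close> and probability close to
one under every spiked law. For one observation the mixed second moment of the likelihood ratios for \<open>v\<close> and
\<open>w\<close> is at most \<open>exp (\<theta>\<^sup>2 \<langle>v, w\<rangle>\<^sup>2)\<close>, so the question is to bound the mean of
\<open>exp (n \<theta>\<^sup>2 \<langle>v, w\<rangle>\<^sup>2)\<close>. Here \<open>s \<langle>v, w\<rangle>\<close> is a sum of \<open>s\<close> independent signs that vanish with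
probability \<open>1 - 1 / m\<close>. Such a rare sign is sub-Gaussian with variance proxy of order
\<open>1 / ln (2 e m)\<close> (\<open>rare_sign_mgf\<close>), and this produces the logarithm in the rate. The square in the
exponent is removed by writing it as a Gaussian average of linear exponentials
(\<open>overlap_exp_square_moment\<close>). Contamination is made harmless by taking \<open>Q = N(0, a I)\<close>.

Contamination rate. A centered normal density with standard deviation \<open>\<sigma> < 1\<close> is at most \<open>1 / \<sigma>\<close>
times the standard normal density. With \<open>\<sigma> = 1 - \<epsilon> / 2\<close> the law \<open>N(0, a I)\<close> therefore dominates
\<open>1 - \<epsilon>\<close> times the normal law whose variance in one direction is multiplied by \<open>\<sigma>\<^sup>2\<close>, and the remainder is \<open>\<epsilon>\<close>
times a probability law \<open>Q\<close>. Hence a suitable contamination makes the two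
covariances produce exactly the same data (\<open>contamination_hides_shrinkage\<close>), although they differ by
\<open>a (1 - \<sigma>\<^sup>2)\<close>, which is of order \<open>\<epsilon>\<close>.

Both parts need the density of \<open>N(0, a (I + \<theta> v v\<^sup>T))\<close> relative to \<open>N(0, a I)\<close>. As the positive
semidefinite square root is unique (\<open>psd_square_injective\<close>), the square root of a spiked matrix is
again spiked, so that the law is the image of a standard Gaussian under a map \<open>I + \<kappa> v v\<^sup>T\<close>. The
change of variables for these maps follows from one-dimensional affine substitutions
(\<open>nn_integral_lborel_rank_one\<close>).
\<close>

section \<open>Lebesgue measure under rank-one linear maps\<close>

lemma measurable_into_PiM_real:
  fixes f :: "'a \<Rightarrow> 'i \<Rightarrow> real"
  assumes "\<And>i. i \<in> I \<Longrightarrow> (\<lambda>x. f x i) \<in> borel_measurable N"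
    and "\<And>x. x \<in> space N \<Longrightarrow> f x \<in> extensional I"
  shows "f \<in> measurable N (PiM I (\<lambda>_. lborel))"
  using measurable_PiM_single'[of I "\<lambda>i x. f x i" N "\<lambda>_. lborel"] assms
  by (auto simp: PiE_def)

text \<open>
By Fubini the integral over coordinate \<open>i\<close> can be done first, and there the offset \<open>g\<close> is a
constant because it depends only on the remaining coordinates. This is the only substitution rule
used below; all others are compositions of it.
\<close>

lemma nn_integral_lborel_affine_coordinate:
  fixes \<alpha> :: real and g :: "('i \<Rightarrow> real) \<Rightarrow> real" and F :: "('i \<Rightarrow> real) \<Rightarrow> ennreal"
  assumes I: "finite I" "i \<in> I" and "\<alpha> \<noteq> 0"
    and [measurable]: "g \<in> borel_measurable (PiM I (\<lambda>_. lborel))"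
      "F \<in> borel_measurable (PiM I (\<lambda>_. lborel))"
    and indep: "\<And>x y. g (x(i := y)) = g x"
  shows "(\<integral>\<^sup>+x. F x \<partial>PiM I (\<lambda>_. lborel)) =
    \<bar>\<alpha>\<bar> * (\<integral>\<^sup>+x. F (x(i := \<alpha> * x i + g x)) \<partial>PiM I (\<lambda>_. lborel))"
proof -
  interpret product_sigma_finite "\<lambda>_::'i. lborel :: real measure" ..
  define J where "J = I - {i}"
  have J: "finite J" "i \<notin> J" "I = insert i J"
    using I by (auto simp: J_def)
  let ?F' = "\<lambda>x. F (x(i := \<alpha> * x i + g x))"
  have upd: "(\<lambda>x. x(i := \<alpha> * x i + g x)) \<in> measurable (PiM I (\<lambda>_. lborel)) (PiM I (\<lambda>_. lborel))"
  proof (rule measurable_into_PiM_real)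
    show "(\<lambda>x. (x(i := \<alpha> * x i + g x)) j) \<in> borel_measurable (PiM I (\<lambda>_. lborel))" if "j \<in> I" for j
      using I that by (cases "j = i") auto
  qed (use I in \<open>auto simp: space_PiM PiE_def extensional_def\<close>)
  have F': "?F' \<in> borel_measurable (PiM I (\<lambda>_. lborel))"
    using assms(5) by (rule measurable_compose[OF upd])
  have aff: "(\<integral>\<^sup>+y. F (x(i := y)) \<partial>lborel) =
      \<bar>\<alpha>\<bar> * (\<integral>\<^sup>+y. F (x(i := g x + \<alpha> * y)) \<partial>lborel)"
    if x: "x \<in> space (PiM J (\<lambda>_. lborel))" for x
  proof (rule nn_integral_real_affine[OF _ \<open>\<alpha> \<noteq> 0\<close>])
    have "(\<lambda>y. x(i := y)) \<in> measurable lborel (PiM I (\<lambda>_. lborel))"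
      by (rule measurable_into_PiM_real)
        (use x J in \<open>auto simp: space_PiM PiE_def extensional_def fun_upd_def\<close>)
    from measurable_compose[OF this, of F borel]
    show "(\<lambda>y. F (x(i := y))) \<in> borel_measurable borel" by simp
  qed
  have meas: "(\<lambda>x. \<integral>\<^sup>+y. F (x(i := g x + \<alpha> * y)) \<partial>lborel) \<in> borel_measurable (PiM J (\<lambda>_. lborel))"
  proof -
    have "(\<lambda>p. (fst p)(i := snd p)) \<in>
        measurable (PiM J (\<lambda>_. lborel) \<Otimes>\<^sub>M lborel) (PiM I (\<lambda>_. lborel :: real measure))"
      using measurable_add_dim[of i J "\<lambda>_. lborel :: real measure"] J(3)
      by (simp add: case_prod_beta)
    from measurable_compose[OF this F']
    have "(\<lambda>p. ?F' ((fst p)(i := snd p))) \<in> borel_measurable (PiM J (\<lambda>_. lborel) \<Otimes>\<^sub>M lborel)" .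
    then show ?thesis
      by (intro lborel.borel_measurable_nn_integral) (simp add: indep case_prod_beta add.commute)
  qed
  have "(\<integral>\<^sup>+x. F x \<partial>PiM I (\<lambda>_. lborel)) =
      (\<integral>\<^sup>+x. \<integral>\<^sup>+y. F (x(i := y)) \<partial>lborel \<partial>PiM J (\<lambda>_. lborel))"
    using product_nn_integral_insert[OF J(1,2), of F] J(3) assms(5) by simp
  also have "\<dots> = (\<integral>\<^sup>+x. \<bar>\<alpha>\<bar> * (\<integral>\<^sup>+y. F (x(i := g x + \<alpha> * y)) \<partial>lborel) \<partial>PiM J (\<lambda>_. lborel))"
    by (rule nn_integral_cong) (rule aff)
  also have "\<dots> = \<bar>\<alpha>\<bar> * (\<integral>\<^sup>+x. \<integral>\<^sup>+y. F (x(i := g x + \<alpha> * y)) \<partial>lborel \<partial>PiM J (\<lambda>_. lborel))"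
    by (rule nn_integral_cmult) (rule meas)
  also have "(\<integral>\<^sup>+x. \<integral>\<^sup>+y. F (x(i := g x + \<alpha> * y)) \<partial>lborel \<partial>PiM J (\<lambda>_. lborel)) =
      (\<integral>\<^sup>+x. ?F' x \<partial>PiM I (\<lambda>_. lborel))"
    using product_nn_integral_insert[OF J(1,2), of ?F'] J(3) F'
    by (simp add: indep add.commute)
  finally show ?thesis .
qed

text \<open>
A shear in direction of the coordinates in \<open>J\<close> is a composition of translations of one coordinate
at a time, each by an amount that depends on coordinate \<open>i\<close> alone.
\<close>

lemma nn_integral_lborel_shear:
  fixes w :: "'i \<Rightarrow> real" and F :: "('i \<Rightarrow> real) \<Rightarrow> ennreal"
  assumes "finite I" "i \<in> I" "finite J" "J \<subseteq> I" "i \<notin> J"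
    and F: "F \<in> borel_measurable (PiM I (\<lambda>_. lborel))"
  shows "(\<integral>\<^sup>+x. F (\<lambda>j. if j \<in> J then x j + x i * w j else x j) \<partial>PiM I (\<lambda>_. lborel)) =
    (\<integral>\<^sup>+x. F x \<partial>PiM I (\<lambda>_. lborel))"
  using assms(3,4,5) F
proof (induction J arbitrary: F rule: finite_induct)
  case empty
  then show ?case by simp
next
  case (insert k J)
  note ins = insert
  let ?upd = "\<lambda>x. x(k := 1 * x k + x i * w k)"
  have upd: "?upd \<in> measurable (PiM I (\<lambda>_. lborel)) (PiM I (\<lambda>_. lborel))"
  proof (rule measurable_into_PiM_real)
    show "(\<lambda>x. ?upd x j) \<in> borel_measurable (PiM I (\<lambda>_. lborel))" if "j \<in> I" for j
      using ins assms that by (cases "j = k") auto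
  qed (use ins in \<open>auto simp: space_PiM PiE_def extensional_def\<close>)
  have F': "(\<lambda>x. F (?upd x)) \<in> borel_measurable (PiM I (\<lambda>_. lborel))"
    using measurable_compose[OF upd ins(6)] .
  have "(\<lambda>j. if j \<in> insert k J then x j + x i * w j else x j) =
      ?upd (\<lambda>j. if j \<in> J then x j + x i * w j else x j)" for x
    using ins by auto
  then have "(\<integral>\<^sup>+x. F (\<lambda>j. if j \<in> insert k J then x j + x i * w j else x j) \<partial>PiM I (\<lambda>_. lborel)) =
      (\<integral>\<^sup>+x. F (?upd (\<lambda>j. if j \<in> J then x j + x i * w j else x j)) \<partial>PiM I (\<lambda>_. lborel))"
    by presburger
  also have "\<dots> = (\<integral>\<^sup>+x. F (?upd x) \<partial>PiM I (\<lambda>_. lborel))"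
    by (rule ins(3)[OF _ _ F']) (use ins(4,5) in auto)
  also have "\<dots> = (\<integral>\<^sup>+x. F x \<partial>PiM I (\<lambda>_. lborel))"
  proof -
    have "(\<lambda>x. x i * w k) \<in> borel_measurable (PiM I (\<lambda>_. lborel))"
      using assms by measurable
    then show ?thesis
      using nn_integral_lborel_affine_coordinate[of I k 1 "\<lambda>x. x i * w k" F] assms ins by auto
  qed
  finally show ?case .
qed

text \<open>
After replacing coordinate \<open>i\<close> by \<open>y = \<langle>v, x\<rangle>\<close> the map \<open>x \<mapsto> x + \<kappa> \<langle>v, x\<rangle> v\<close> becomes the shear
\<open>x\<^sub>j \<mapsto> x\<^sub>j + \<kappa> y v\<^sub>j\<close> followed by the scaling \<open>y \<mapsto> (1 + \<kappa> |v|\<^sup>2) y\<close>. The Jacobian \<open>|v\<^sub>i|\<close> of the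
replacement occurs on both sides and cancels, so the scaling factor alone survives.
\<close>

lemma nn_integral_lborel_rank_one:
  fixes v :: "'i \<Rightarrow> real" and F :: "('i \<Rightarrow> real) \<Rightarrow> ennreal"
  assumes I: "finite I" "i \<in> I" and vi: "v i \<noteq> 0" and d: "1 + \<kappa> * (\<Sum>j\<in>I. (v j)\<^sup>2) \<noteq> 0"
    and F: "F \<in> borel_measurable (PiM I (\<lambda>_. lborel))"
  shows "(\<integral>\<^sup>+x. F x \<partial>PiM I (\<lambda>_. lborel)) =
    \<bar>1 + \<kappa> * (\<Sum>j\<in>I. (v j)\<^sup>2)\<bar> *
    (\<integral>\<^sup>+x. F (\<lambda>j\<in>I. x j + \<kappa> * (\<Sum>l\<in>I. v l * x l) * v j) \<partial>PiM I (\<lambda>_. lborel))"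
proof -
  let ?L = "PiM I (\<lambda>_. lborel) :: ('i \<Rightarrow> real) measure"
  let ?d = "1 + \<kappa> * (\<Sum>j\<in>I. (v j)\<^sup>2)"
  define J where "J = I - {i}"
  have J: "finite J" "i \<notin> J" "I = insert i J" using I by (auto simp: J_def)
  define r where "r = (\<lambda>x::'i \<Rightarrow> real. \<Sum>j\<in>J. v j * x j)"
  have sumI: "(\<Sum>j\<in>I. f j) = f i + (\<Sum>j\<in>J. f j)" for f :: "'i \<Rightarrow> real"
    using J by simp
  have r_upd: "r (x(i := y)) = r x" for x y
    unfolding r_def using J by (intro sum.cong) auto
  have r_meas [measurable]: "r \<in> borel_measurable ?L"
    unfolding r_def using J by (intro borel_measurable_sum borel_measurable_times) auto
  \<comment> \<open>\<open>S\<close> is the replacement of coordinate \<open>i\<close> by \<open>\<langle>v, x\<rangle>\<close>, and \<open>H\<close> is \<open>F\<close> in the new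
     coordinates.\<close>
  define H where "H = (\<lambda>y. F (y(i := inverse (v i) * y i + - inverse (v i) * r y)))"
  have upd_meas: "(\<lambda>x. x(i := g x)) \<in> measurable ?L ?L" if "g \<in> borel_measurable ?L" for g
  proof (rule measurable_into_PiM_real)
    show "(\<lambda>x. (x(i := g x)) j) \<in> borel_measurable ?L" if "j \<in> I" for j
      using \<open>g \<in> borel_measurable ?L\<close> that by (cases "j = i") auto
  qed (use I in \<open>auto simp: space_PiM PiE_def extensional_def\<close>)
  have "(\<lambda>y. inverse (v i) * y i + - inverse (v i) * r y) \<in> borel_measurable ?L"
    using I by measurable
  from measurable_compose[OF upd_meas[OF this] F]
  have H: "H \<in> borel_measurable ?L" unfolding H_def .
  define S where "S = (\<lambda>x::'i \<Rightarrow> real. x(i := v i * x i + r x))"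
  have S: "S \<in> measurable ?L ?L"
    unfolding S_def using I by (intro upd_meas) measurable
  have FS: "F x = H (S x)" for x
    unfolding H_def S_def using vi by (simp add: r_upd field_simps)
  define N where "N = (\<lambda>y::'i \<Rightarrow> real. y(i := ?d * y i + 0))"
  have N: "N \<in> measurable ?L ?L"
    unfolding N_def using I by (intro upd_meas) measurable
  define W where "W = (\<lambda>x j. if j \<in> J then x j + x i * (\<kappa> * v j) else x j)"
  have W: "W \<in> measurable ?L ?L"
  proof (rule measurable_into_PiM_real)
    show "(\<lambda>x. W x j) \<in> borel_measurable ?L" if "j \<in> I" for j
      using that I unfolding W_def by (cases "j \<in> J") auto
  qed (use J in \<open>auto simp: W_def space_PiM PiE_def extensional_def\<close>)
  let ?B = "\<lambda>x. \<lambda>j\<in>I. x j + \<kappa> * (\<Sum>l\<in>I. v l * x l) * v j"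
  have SB: "S (?B x) = N (W (S x))" if "x \<in> space ?L" for x
  proof
    fix j
    have rB: "r (?B x) = r x + \<kappa> * (\<Sum>l\<in>I. v l * x l) * (\<Sum>l\<in>J. (v l)\<^sup>2)"
    proof -
      have "r (?B x) = (\<Sum>l\<in>J. v l * x l + \<kappa> * (\<Sum>l\<in>I. v l * x l) * (v l)\<^sup>2)"
        unfolding r_def using J by (intro sum.cong) (auto simp: field_simps power2_eq_square)
      then show ?thesis by (simp add: r_def sum.distrib sum_distrib_left)
    qed
    have s: "(\<Sum>l\<in>I. v l * x l) = v i * x i + r x" by (simp add: sumI r_def)
    consider "j = i" | "j \<in> J" | "j \<notin> I" using J by auto
    then show "S (?B x) j = N (W (S x)) j"
    proof cases
      case 1
      define q where "q = (\<Sum>l\<in>I. v l * x l)"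
      have "S (?B x) j = v i * (x i + \<kappa> * q * v i) + r (?B x)"
        using 1 I by (simp add: S_def q_def)
      also have "r (?B x) = r x + \<kappa> * q * (\<Sum>l\<in>J. (v l)\<^sup>2)"
        using rB by (simp only: q_def)
      also have "v i * (x i + \<kappa> * q * v i) + (r x + \<kappa> * q * (\<Sum>l\<in>J. (v l)\<^sup>2)) = ?d * q"
        unfolding sumI[of "\<lambda>l. (v l)\<^sup>2"] using s
        by (simp add: q_def[symmetric] algebra_simps power2_eq_square)
      also have "\<dots> = N (W (S x)) j"
        using 1 J(2) by (simp add: S_def N_def W_def q_def s)
      finally show ?thesis .
    next
      case 2
      then show ?thesis using J by (auto simp: S_def N_def W_def s sumI r_def)
    next
      case 3
      then show ?thesis using J that
        by (auto simp: S_def N_def W_def space_PiM PiE_def extensional_def)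
    qed
  qed
  have HN: "(\<lambda>x. H (N x)) \<in> borel_measurable ?L"
    by (rule measurable_compose[OF N H])
  have HNW: "(\<lambda>x. H (N (W x))) \<in> borel_measurable ?L"
    by (rule measurable_compose[OF W HN])
  have S_int: "(\<integral>\<^sup>+x. G x \<partial>?L) = \<bar>v i\<bar> * (\<integral>\<^sup>+x. G (S x) \<partial>?L)" if "G \<in> borel_measurable ?L" for G
    unfolding S_def
    by (rule nn_integral_lborel_affine_coordinate
        [where F = G and g = r and \<alpha> = "v i", OF I vi r_meas that r_upd])
  have N_int: "(\<integral>\<^sup>+x. H x \<partial>?L) = \<bar>?d\<bar> * (\<integral>\<^sup>+x. H (N x) \<partial>?L)"
    unfolding N_def
    by (rule nn_integral_lborel_affine_coordinate[where g = "\<lambda>_. 0", OF I d _ H]) auto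
  have W_int: "(\<integral>\<^sup>+x. H (N (W x)) \<partial>?L) = (\<integral>\<^sup>+x. H (N x) \<partial>?L)"
    unfolding W_def using J I HN by (intro nn_integral_lborel_shear) auto
  have "\<bar>v i\<bar> * (\<integral>\<^sup>+x. F x \<partial>?L) = \<bar>v i\<bar> * (\<integral>\<^sup>+x. H (S x) \<partial>?L)"
    by (simp add: FS)
  also have "\<dots> = (\<integral>\<^sup>+x. H x \<partial>?L)"
    by (rule S_int[OF H, symmetric])
  also have "\<dots> = \<bar>?d\<bar> * (\<integral>\<^sup>+x. H (N (W x)) \<partial>?L)"
    unfolding N_int W_int ..
  also have "\<dots> = \<bar>?d\<bar> * (\<bar>v i\<bar> * (\<integral>\<^sup>+x. H (N (W (S x))) \<partial>?L))"
    by (subst S_int[OF HNW]) (rule refl)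
  also have "(\<integral>\<^sup>+x. H (N (W (S x))) \<partial>?L) = (\<integral>\<^sup>+x. F (?B x) \<partial>?L)"
    by (rule nn_integral_cong) (simp only: FS SB)
  finally have "ennreal \<bar>v i\<bar> * (\<integral>\<^sup>+x. F x \<partial>?L) =
      ennreal \<bar>v i\<bar> * (ennreal \<bar>?d\<bar> * (\<integral>\<^sup>+x. F (?B x) \<partial>?L))"
    by (simp only: mult.left_commute)
  then show ?thesis
    using vi by (subst (asm) ennreal_mult_cancel_left) auto
qed

section \<open>Rank-one perturbations of the standard Gaussian law\<close>

lemma PiM_density:
  assumes I: "finite I" and M: "\<And>i. sigma_finite_measure (M i)"
    and D: "\<And>i. sigma_finite_measure (density (M i) (f i))"
    and f[measurable]: "\<And>i. f i \<in> borel_measurable (M i)"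
  shows "PiM I (\<lambda>i. density (M i) (f i)) = density (PiM I M) (\<lambda>x. \<Prod>i\<in>I. f i (x i))"
proof -
  interpret M: product_sigma_finite M by (rule product_sigma_finite.intro) (rule M)
  interpret D: product_sigma_finite "\<lambda>i. density (M i) (f i)"
    by (rule product_sigma_finite.intro) (rule D)
  have prod_meas [measurable]: "(\<lambda>x. \<Prod>i\<in>I. f i (x i)) \<in> borel_measurable (PiM I M)"
    using I by (intro borel_measurable_prod_ennreal) measurable
  show ?thesis
  proof (rule D.PiM_eqI[OF I, symmetric])
    show "sets (density (PiM I M) (\<lambda>x. \<Prod>i\<in>I. f i (x i))) = sets (PiM I (\<lambda>i. density (M i) (f i)))"
      by (auto intro!: sets_PiM_cong)
  next
    fix A assume "\<And>i. i \<in> I \<Longrightarrow> A i \<in> sets (density (M i) (f i))"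
    then have A: "\<And>i. i \<in> I \<Longrightarrow> A i \<in> sets (M i)" by simp
    have "emeasure (density (PiM I M) (\<lambda>x. \<Prod>i\<in>I. f i (x i))) (Pi\<^sub>E I A) =
        (\<integral>\<^sup>+x. (\<Prod>i\<in>I. f i (x i)) * indicator (Pi\<^sub>E I A) x \<partial>PiM I M)"
      using A I by (intro emeasure_density prod_meas sets_PiM_I_finite)
    also have "\<dots> = (\<integral>\<^sup>+x. (\<Prod>i\<in>I. f i (x i) * indicator (A i) (x i)) \<partial>PiM I M)"
    proof (rule nn_integral_cong)
      fix x assume x: "x \<in> space (PiM I M)"
      have "indicator (Pi\<^sub>E I A) x = (\<Prod>i\<in>I. indicator (A i) (x i) :: ennreal)"
      proof (cases "x \<in> Pi\<^sub>E I A")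
        case True
        then show ?thesis by (auto simp: PiE_def Pi_def)
      next
        case False
        then obtain i where "i \<in> I" "x i \<notin> A i"
          using x by (auto simp: space_PiM PiE_def Pi_def)
        then show ?thesis using False I by (auto simp: indicator_def)
      qed
      then show "(\<Prod>i\<in>I. f i (x i)) * indicator (Pi\<^sub>E I A) x =
          (\<Prod>i\<in>I. f i (x i) * indicator (A i) (x i))"
        by (simp add: prod.distrib)
    qed
    also have "\<dots> = (\<Prod>i\<in>I. \<integral>\<^sup>+x. f i x * indicator (A i) x \<partial>M i)"
      using A I by (intro M.product_nn_integral_prod) auto
    also have "\<dots> = (\<Prod>i\<in>I. emeasure (density (M i) (f i)) (A i))"
      using A by (intro prod.cong) (auto simp: emeasure_density)
    finally show "emeasure (density (PiM I M) (\<lambda>x. \<Prod>i\<in>I. f i (x i))) (Pi\<^sub>E I A) =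
        (\<Prod>i\<in>I. emeasure (density (M i) (f i)) (A i))" .
  qed
qed

definition dot :: "'i set \<Rightarrow> ('i \<Rightarrow> real) \<Rightarrow> ('i \<Rightarrow> real) \<Rightarrow> real" where
  "dot I v x = (\<Sum>i\<in>I. v i * x i)"

lemma dot_measurable [measurable]:
  assumes "\<And>i. sets (M i) = sets borel"
  shows "dot I v \<in> borel_measurable (PiM I M)"
proof -
  have "(\<lambda>x. x i) \<in> borel_measurable (PiM I M)" if "i \<in> I" for i
    using measurable_component_singleton[OF that, of M]
      measurable_cong_sets[OF refl assms[of i], of "PiM I M"] by simp
  then show ?thesis unfolding dot_def
    by (intro borel_measurable_sum borel_measurable_times) auto
qed

text \<open>
The linear map \<open>I + \<kappa> v v\<^sup>T\<close>. The restriction to \<open>I\<close> keeps its values in the space of the product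
measure.
\<close>

definition stretch :: "'i set \<Rightarrow> real \<Rightarrow> ('i \<Rightarrow> real) \<Rightarrow> ('i \<Rightarrow> real) \<Rightarrow> 'i \<Rightarrow> real" where
  "stretch I \<kappa> v x = (\<lambda>i\<in>I. x i + \<kappa> * dot I v x * v i)"

lemma dot_stretch: "dot I w (stretch I \<kappa> v x) = dot I w x + \<kappa> * dot I v x * dot I w v"
proof -
  define q where "q = \<kappa> * dot I v x"
  have "dot I w (stretch I \<kappa> v x) = (\<Sum>i\<in>I. w i * x i + q * (w i * v i))"
    unfolding dot_def[of I w "stretch I \<kappa> v x"] unfolding stretch_def q_def
    by (intro sum.cong) (auto simp: algebra_simps)
  also have "\<dots> = dot I w x + q * dot I w v"
    by (simp add: dot_def sum.distrib sum_distrib_left)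
  finally show ?thesis by (simp add: q_def)
qed

lemma norm_stretch:
  assumes "dot I v v = 1"
  shows "(\<Sum>i\<in>I. (stretch I \<kappa> v x i)\<^sup>2) = (\<Sum>i\<in>I. (x i)\<^sup>2) + ((1 + \<kappa>)\<^sup>2 - 1) * (dot I v x)\<^sup>2"
proof -
  have "(\<Sum>i\<in>I. (stretch I \<kappa> v x i)\<^sup>2) =
      (\<Sum>i\<in>I. (x i)\<^sup>2 + 2 * \<kappa> * dot I v x * (v i * x i) + (\<kappa> * dot I v x)\<^sup>2 * (v i * v i))"
    unfolding stretch_def by (intro sum.cong) (auto simp: algebra_simps power2_eq_square)
  also have "\<dots> = (\<Sum>i\<in>I. (x i)\<^sup>2) + 2 * \<kappa> * dot I v x * dot I v x + (\<kappa> * dot I v x)\<^sup>2 * dot I v v"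
    by (simp add: sum.distrib dot_def sum_distrib_left)
  finally show ?thesis using assms by (simp add: algebra_simps power2_eq_square)
qed

definition std_gaussian :: "'i set \<Rightarrow> ('i \<Rightarrow> real) measure" where
  "std_gaussian I = PiM I (\<lambda>_. density lborel (\<lambda>x. ennreal (std_normal_density x)))"

lemma sets_std_gaussian [measurable_cong]: "sets (std_gaussian I) = sets (PiM I (\<lambda>_. borel))"
  unfolding std_gaussian_def by (intro sets_PiM_cong) auto

lemma prob_space_std_gaussian: "prob_space (std_gaussian I)"
  unfolding std_gaussian_def
  by (intro prob_space_PiM prob_space_normal_density) simp

lemma std_gaussian_density:
  assumes "finite I"
  shows "std_gaussian I = density (PiM I (\<lambda>_. lborel))
    (\<lambda>x. ennreal ((1 / sqrt (2 * pi)) ^ card I * exp (- (\<Sum>i\<in>I. (x i)\<^sup>2) / 2)))"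
proof -
  have "std_gaussian I = density (PiM I (\<lambda>_. lborel)) (\<lambda>x. \<Prod>i\<in>I. ennreal (std_normal_density (x i)))"
    unfolding std_gaussian_def
    using prob_space_normal_density[of 1 0]
    by (intro PiM_density assms) (auto intro!: sigma_finite_lborel prob_space_imp_sigma_finite)
  also have "(\<lambda>x. \<Prod>i\<in>I. ennreal (std_normal_density (x i))) =
      (\<lambda>x. ennreal ((1 / sqrt (2 * pi)) ^ card I * exp (- (\<Sum>i\<in>I. (x i)\<^sup>2) / 2)))"
  proof
    fix x :: "'a \<Rightarrow> real"
    have "(\<Prod>i\<in>I. std_normal_density (x i)) =
        (1 / sqrt (2 * pi)) ^ card I * (\<Prod>i\<in>I. exp (- (x i)\<^sup>2 / 2))"
      unfolding std_normal_density_def prod.distrib by simp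
    also have "(\<Prod>i\<in>I. exp (- (x i)\<^sup>2 / 2)) = exp (- (\<Sum>i\<in>I. (x i)\<^sup>2) / 2)"
      using assms by (simp add: exp_sum[symmetric] sum_divide_distrib sum_negf)
    finally show "(\<Prod>i\<in>I. ennreal (std_normal_density (x i))) =
        ennreal ((1 / sqrt (2 * pi)) ^ card I * exp (- (\<Sum>i\<in>I. (x i)\<^sup>2) / 2))"
      by (simp add: prod_ennreal)
  qed
  finally show ?thesis .
qed

text \<open>
For a unit vector \<open>v\<close> this is the density of \<open>N(0, I + \<theta> v v\<^sup>T)\<close> with respect to \<open>N(0, I)\<close>.
\<close>

definition spike_density :: "'i set \<Rightarrow> real \<Rightarrow> ('i \<Rightarrow> real) \<Rightarrow> ('i \<Rightarrow> real) \<Rightarrow> real" where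
  "spike_density I \<theta> v x = exp (\<theta> / (1 + \<theta>) * (dot I v x)\<^sup>2 / 2) / sqrt (1 + \<theta>)"

lemma spike_density_measurable [measurable]:
  assumes "\<And>i. sets (M i) = sets borel"
  shows "spike_density I \<theta> v \<in> borel_measurable (PiM I M)"
proof -
  note dot_measurable[OF assms, measurable]
  show ?thesis unfolding spike_density_def by measurable
qed

lemma spike_density_nonneg: "\<theta> > -1 \<Longrightarrow> 0 \<le> spike_density I \<theta> v x"
  by (simp add: spike_density_def)

lemma stretch_measurable:
  assumes "\<And>i. sets (M i) = sets borel"
  shows "stretch I \<kappa> v \<in> measurable (PiM I M) (PiM I (\<lambda>_. borel))"
proof -
  note dot_measurable[OF assms, measurable]
  have c: "(\<lambda>x. x i) \<in> borel_measurable (PiM I M)" if "i \<in> I" for i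
    using measurable_component_singleton[OF that, of M]
      measurable_cong_sets[OF refl assms[of i], of "PiM I M"] by simp
  show ?thesis
    unfolding stretch_def
    by (intro measurable_restrict borel_measurable_add borel_measurable_times c dot_measurable assms) auto
qed

text \<open>
The change of variables has Jacobian \<open>1 + \<kappa> = sqrt (1 + \<theta>)\<close>, and the squared norm of the image of
\<open>x\<close> exceeds that of \<open>x\<close> by \<open>\<theta> \<langle>v, x\<rangle>\<^sup>2\<close>. Both corrections are absorbed by the spike density.
\<close>

lemma stretched_gaussian_density:
  assumes I: "finite I" and v: "dot I v v = 1" and \<theta>: "\<theta> > -1"
    and F: "F \<in> borel_measurable (PiM I (\<lambda>_. borel))"
  shows "(\<integral>\<^sup>+z. F (stretch I (sqrt (1 + \<theta>) - 1) v z) \<partial>std_gaussian I) =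
    (\<integral>\<^sup>+x. F x * ennreal (spike_density I \<theta> v x) \<partial>std_gaussian I)"
proof -
  let ?L = "PiM I (\<lambda>_. lborel) :: ('a \<Rightarrow> real) measure"
  let ?\<Phi> = "\<lambda>x. (1 / sqrt (2 * pi)) ^ card I * exp (- (\<Sum>i\<in>I. (x i)\<^sup>2) / 2)"
  define \<kappa> where "\<kappa> = sqrt (1 + \<theta>) - 1"
  have \<kappa>: "(1 + \<kappa>)\<^sup>2 = 1 + \<theta>" "1 + \<kappa> > 0" using \<theta> by (auto simp: \<kappa>_def)
  have sets_L: "sets ?L = sets (PiM I (\<lambda>_. borel))" by (intro sets_PiM_cong) auto
  have FL [measurable]: "F \<in> borel_measurable ?L"
    using F measurable_cong_sets[OF sets_L refl] by auto
  have \<Phi>_meas [measurable]: "?\<Phi> \<in> borel_measurable ?L"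
  proof -
    have "(\<lambda>x. \<Sum>i\<in>I. (x i)\<^sup>2) \<in> borel_measurable ?L"
      by (intro borel_measurable_sum borel_measurable_power) auto
    then show ?thesis by measurable
  qed
  have [measurable]: "spike_density I \<theta> v \<in> borel_measurable ?L"
    by (rule spike_density_measurable) simp
  have st_meas: "stretch I \<kappa> v \<in> measurable ?L (PiM I (\<lambda>_. borel))"
    by (rule stretch_measurable) simp
  have FB_meas: "(\<lambda>x. F (stretch I \<kappa> v x)) \<in> borel_measurable ?L"
    by (rule measurable_compose[OF st_meas F])
  obtain i where i: "i \<in> I" "v i \<noteq> 0"
  proof -
    have "\<exists>i\<in>I. v i \<noteq> 0"
    proof (rule ccontr)
      assume "\<not> ?thesis"
      then have "dot I v v = 0" unfolding dot_def by (intro sum.neutral) auto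
      then show False using v by simp
    qed
    then show ?thesis using that by blast
  qed
  have v2: "(\<Sum>j\<in>I. (v j)\<^sup>2) = 1" using v by (simp add: dot_def power2_eq_square)
  define G where "G = (\<lambda>x. F x * ennreal (spike_density I \<theta> v x * ?\<Phi> x))"
  have G: "G \<in> borel_measurable ?L" unfolding G_def by measurable
  have key: "(1 + \<kappa>) * (spike_density I \<theta> v (stretch I \<kappa> v x) * ?\<Phi> (stretch I \<kappa> v x)) = ?\<Phi> x" for x
  proof -
    have d: "dot I v (stretch I \<kappa> v x) = (1 + \<kappa>) * dot I v x"
      using dot_stretch[of I v \<kappa> v x] v by (simp add: algebra_simps)
    have "\<theta> / (1 + \<theta>) * (dot I v (stretch I \<kappa> v x))\<^sup>2 = \<theta> * (dot I v x)\<^sup>2"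
      unfolding d power_mult_distrib \<kappa> using \<theta> by simp
    then have "spike_density I \<theta> v (stretch I \<kappa> v x) = exp (\<theta> * (dot I v x)\<^sup>2 / 2) / (1 + \<kappa>)"
      unfolding spike_density_def by (simp add: \<kappa>_def)
    moreover have "exp (\<theta> * (dot I v x)\<^sup>2 / 2) *
        exp (- ((\<Sum>i\<in>I. (x i)\<^sup>2) + \<theta> * (dot I v x)\<^sup>2) / 2) = exp (- (\<Sum>i\<in>I. (x i)\<^sup>2) / 2)"
      by (simp add: exp_add[symmetric] add_divide_distrib diff_divide_distrib)
    ultimately show ?thesis
      using \<kappa> unfolding norm_stretch[OF v] by (simp add: mult.left_commute)
  qed
  have st_eq: "(\<lambda>j\<in>I. x j + \<kappa> * (\<Sum>l\<in>I. v l * x l) * v j) = stretch I \<kappa> v x" for x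
    by (simp add: stretch_def dot_def)
  have "(\<integral>\<^sup>+x. F x * ennreal (spike_density I \<theta> v x) \<partial>std_gaussian I) = (\<integral>\<^sup>+x. G x \<partial>?L)"
    unfolding std_gaussian_density[OF I] G_def
    by (subst nn_integral_density)
       (auto intro!: nn_integral_cong simp: ennreal_mult[OF spike_density_nonneg] mult_ac \<theta> less_imp_le)
  also have "\<dots> = ennreal (1 + \<kappa>) * (\<integral>\<^sup>+x. G (stretch I \<kappa> v x) \<partial>?L)"
    using nn_integral_lborel_rank_one[where i = i and I = I and v = v and \<kappa> = \<kappa> and F = G] i I G \<kappa>
    unfolding st_eq v2 by simp
  also have "\<dots> = (\<integral>\<^sup>+x. ennreal (1 + \<kappa>) * G (stretch I \<kappa> v x) \<partial>?L)"
    by (rule nn_integral_cmult[symmetric])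
       (rule measurable_compose[OF st_meas], use G measurable_cong_sets[OF sets_L refl] in auto)
  also have "\<dots> = (\<integral>\<^sup>+x. ennreal (?\<Phi> x) * F (stretch I \<kappa> v x) \<partial>?L)"
  proof (rule nn_integral_cong)
    fix x
    have "ennreal (1 + \<kappa>) * G (stretch I \<kappa> v x) = F (stretch I \<kappa> v x) *
      ennreal ((1 + \<kappa>) * (spike_density I \<theta> v (stretch I \<kappa> v x) * ?\<Phi> (stretch I \<kappa> v x)))"
      unfolding G_def using \<kappa> by (subst (2) ennreal_mult') (auto simp: mult_ac)
    then show "ennreal (1 + \<kappa>) * G (stretch I \<kappa> v x) = ennreal (?\<Phi> x) * F (stretch I \<kappa> v x)"
      unfolding key by (simp add: mult_ac)
  qed
  also have "\<dots> = (\<integral>\<^sup>+z. F (stretch I \<kappa> v z) \<partial>std_gaussian I)"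
    unfolding std_gaussian_density[OF I]
    by (rule nn_integral_density[symmetric]) (use FB_meas in auto)
  finally show ?thesis by (simp add: \<kappa>_def)
qed

lemma nn_integral_spike_density:
  assumes "finite I" "dot I v v = 1" "\<theta> > -1"
  shows "(\<integral>\<^sup>+x. ennreal (spike_density I \<theta> v x) \<partial>std_gaussian I) = 1"
  using stretched_gaussian_density[OF assms, of "\<lambda>_. 1"]
    prob_space.emeasure_space_1[OF prob_space_std_gaussian, of I] by simp

text \<open>
Up to the constant \<open>sqrt (1 - b |u|\<^sup>2)\<close>, the integrand is the spike density of the normalised vector
\<open>u / |u|\<close> for \<open>\<theta> = b |u|\<^sup>2 / (1 - b |u|\<^sup>2)\<close>, which integrates to one.
\<close>

lemma nn_integral_exp_square_gaussian:
  assumes I: "finite I" and u: "dot I u u > 0" and b: "b * dot I u u < 1"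
  shows "(\<integral>\<^sup>+x. ennreal (exp (b * (dot I u x)\<^sup>2 / 2)) \<partial>std_gaussian I) =
    ennreal (1 / sqrt (1 - b * dot I u u))"
proof -
  define N where "N = dot I u u"
  define \<theta> where "\<theta> = b * N / (1 - b * N)"
  let ?v = "\<lambda>i. u i / sqrt N"
  have N: "N > 0" "b * N < 1" using u b by (auto simp: N_def)
  have \<theta>1: "1 + \<theta> = 1 / (1 - b * N)" using N by (simp add: \<theta>_def field_simps)
  have \<theta>2: "\<theta> / (1 + \<theta>) = b * N" using N unfolding \<theta>1 by (simp add: \<theta>_def)
  have "1 + \<theta> > 0" unfolding \<theta>1 using N by simp
  then have \<theta>: "\<theta> > -1" by simp
  have dv: "dot I ?v x = dot I u x / sqrt N" for x
    by (simp add: dot_def sum_divide_distrib)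
  have vv: "dot I ?v ?v = 1"
  proof -
    have "dot I ?v ?v = (\<Sum>i\<in>I. u i * u i / N)" unfolding dot_def using N by (intro sum.cong) auto
    also have "\<dots> = 1" using N by (simp add: sum_divide_distrib[symmetric] N_def dot_def)
    finally show ?thesis .
  qed
  have eq: "exp (b * (dot I u x)\<^sup>2 / 2) = spike_density I \<theta> ?v x * (1 / sqrt (1 - b * N))" for x
  proof -
    have "b * N * (dot I u x / sqrt N)\<^sup>2 = b * (dot I u x)\<^sup>2"
      using N by (auto simp: power_divide)
    then show ?thesis
      unfolding spike_density_def \<theta>2 dv unfolding \<theta>1 using N by (auto simp: real_sqrt_divide)
  qed
  have [measurable]: "spike_density I \<theta> ?v \<in> borel_measurable (std_gaussian I)"
    unfolding std_gaussian_def by (rule spike_density_measurable) simp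
  have "(\<integral>\<^sup>+x. ennreal (exp (b * (dot I u x)\<^sup>2 / 2)) \<partial>std_gaussian I) =
      (\<integral>\<^sup>+x. ennreal (spike_density I \<theta> ?v x) * ennreal (1 / sqrt (1 - b * N)) \<partial>std_gaussian I)"
    unfolding eq using N \<theta> by (intro nn_integral_cong ennreal_mult) (auto simp: spike_density_def)
  also have "\<dots> = ennreal (1 / sqrt (1 - b * N))"
    by (subst nn_integral_multc) (auto simp: nn_integral_spike_density[OF I vv \<theta>])
  finally show ?thesis by (simp add: N_def)
qed

lemma dot_commute: "dot I v w = dot I w v"
  by (simp add: dot_def mult.commute)

lemma dot_Cauchy_Schwarz: "(dot I v w)\<^sup>2 \<le> dot I v v * dot I w w"
  using Cauchy_Schwarz_ineq_sum[of v w I] by (simp add: dot_def power2_eq_square)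

text \<open>
The product is integrated by regarding the first factor as a change of measure: under it \<open>\<langle>w, x\<rangle>\<close>
becomes \<open>\<langle>u, z\<rangle>\<close> with \<open>z\<close> standard Gaussian and \<open>|u|\<^sup>2 = 1 + \<theta> \<langle>v, w\<rangle>\<^sup>2\<close>. The exact value is
\<open>1 / sqrt (1 - \<theta>\<^sup>2 \<langle>v, w\<rangle>\<^sup>2)\<close>, and \<open>1 / sqrt (1 - y) \<le> exp y\<close> for \<open>0 \<le> y \<le> 1 / 2\<close>.
\<close>

lemma spike_density_product_bound:
  assumes I: "finite I" and v: "dot I v v = 1" and w: "dot I w w = 1"
    and \<theta>: "\<theta> > 0" "\<theta>\<^sup>2 \<le> 1 / 2"
  shows "(\<integral>\<^sup>+x. ennreal (spike_density I \<theta> v x) * ennreal (spike_density I \<theta> w x) \<partial>std_gaussian I)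
    \<le> ennreal (exp (\<theta>\<^sup>2 * (dot I v w)\<^sup>2))"
proof -
  define \<rho> where "\<rho> = dot I v w"
  define \<kappa> where "\<kappa> = sqrt (1 + \<theta>) - 1"
  define u where "u = (\<lambda>i. w i + \<kappa> * \<rho> * v i)"
  have \<kappa>: "(1 + \<kappa>)\<^sup>2 = 1 + \<theta>" using \<theta> by (auto simp: \<kappa>_def)
  have du: "dot I w (stretch I \<kappa> v x) = dot I u x" for x
    unfolding dot_stretch by (simp add: u_def dot_commute[of I w v] \<rho>_def)
      (simp add: dot_def sum.distrib sum_distrib_left algebra_simps)
  have \<rho>: "\<rho>\<^sup>2 \<le> 1" using dot_Cauchy_Schwarz[of I v w] v w by (simp add: \<rho>_def)
  have uu: "dot I u u = 1 + \<theta> * \<rho>\<^sup>2"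
  proof -
    have "dot I u u = dot I w w + 2 * \<kappa> * \<rho> * dot I v w + (\<kappa> * \<rho>)\<^sup>2 * dot I v v"
      unfolding u_def dot_def by (simp add: sum.distrib sum_distrib_left algebra_simps power2_eq_square)
    also have "\<dots> = 1 + ((1 + \<kappa>)\<^sup>2 - 1) * \<rho>\<^sup>2"
      using v w by (simp add: \<rho>_def[symmetric] algebra_simps power2_eq_square)
    finally show ?thesis using \<kappa> by simp
  qed
  have x: "\<theta>\<^sup>2 * \<rho>\<^sup>2 \<le> 1 / 2" "0 \<le> \<theta>\<^sup>2 * \<rho>\<^sup>2"
    using mult_mono[OF \<theta>(2) \<rho>] by auto
  have b: "1 - \<theta> / (1 + \<theta>) * dot I u u = (1 - \<theta>\<^sup>2 * \<rho>\<^sup>2) / (1 + \<theta>)"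
    unfolding uu using \<theta> by (simp add: field_simps power2_eq_square)
  have "0 < (1 - \<theta>\<^sup>2 * \<rho>\<^sup>2) / (1 + \<theta>)"
    using x \<theta> by (intro divide_pos_pos) linarith+
  then have b': "\<theta> / (1 + \<theta>) * dot I u u < 1" unfolding b[symmetric] by simp
  have upos: "dot I u u > 0" unfolding uu using \<theta> by (intro add_pos_nonneg) auto
  have wmeas: "(\<lambda>x. ennreal (spike_density I \<theta> w x)) \<in> borel_measurable (PiM I (\<lambda>_. borel))"
    using spike_density_measurable[of "\<lambda>_. borel" I \<theta> w] by simp
  have "(\<integral>\<^sup>+x. ennreal (spike_density I \<theta> v x) * ennreal (spike_density I \<theta> w x) \<partial>std_gaussian I) =
      (\<integral>\<^sup>+x. ennreal (spike_density I \<theta> w (stretch I \<kappa> v x)) \<partial>std_gaussian I)"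
    unfolding \<kappa>_def
    using stretched_gaussian_density[OF I v _ wmeas, of \<theta>] \<theta> by (simp add: mult.commute)
  also have "\<dots> = (\<integral>\<^sup>+x. ennreal (1 / sqrt (1 + \<theta>)) * ennreal (exp (\<theta> / (1 + \<theta>) * (dot I u x)\<^sup>2 / 2)) \<partial>std_gaussian I)"
    unfolding spike_density_def du using \<theta>
    by (intro nn_integral_cong) (simp add: ennreal_mult[symmetric])
  also have "\<dots> = ennreal (1 / sqrt (1 + \<theta>)) *
      (\<integral>\<^sup>+x. ennreal (exp (\<theta> / (1 + \<theta>) * (dot I u x)\<^sup>2 / 2)) \<partial>std_gaussian I)"
  proof (rule nn_integral_cmult)
    have [measurable]: "dot I u \<in> borel_measurable (std_gaussian I)"
      unfolding std_gaussian_def by (rule dot_measurable) simp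
    show "(\<lambda>x. ennreal (exp (\<theta> / (1 + \<theta>) * (dot I u x)\<^sup>2 / 2))) \<in> borel_measurable (std_gaussian I)"
      by measurable
  qed
  also have "\<dots> = ennreal (1 / sqrt (1 + \<theta>)) * ennreal (1 / sqrt ((1 - \<theta>\<^sup>2 * \<rho>\<^sup>2) / (1 + \<theta>)))"
    using nn_integral_exp_square_gaussian[OF I upos b'] b by simp
  also have "\<dots> = ennreal (1 / sqrt (1 - \<theta>\<^sup>2 * \<rho>\<^sup>2))"
    using \<theta> x by (subst ennreal_mult[symmetric]) (auto simp: real_sqrt_divide)
  also have "\<dots> \<le> ennreal (exp (\<theta>\<^sup>2 * \<rho>\<^sup>2))"
  proof (rule ennreal_leI)
    define y where "y = \<theta>\<^sup>2 * \<rho>\<^sup>2"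
    have y: "0 \<le> y" "y \<le> 1 / 2" using x by (auto simp: y_def)
    have "1 \<le> (1 - y) * (1 + 2 * y)"
      using mult_nonneg_nonneg[of y "1 - 2 * y"] y by (simp add: algebra_simps)
    also have "\<dots> \<le> (1 - y) * exp (2 * y)"
      using y exp_ge_add_one_self[of "2 * y"] by (intro mult_left_mono) auto
    finally have "sqrt 1 \<le> sqrt ((1 - y) * exp (2 * y))" by (rule real_sqrt_le_mono)
    also have "\<dots> = sqrt (1 - y) * exp y"
      by (simp add: real_sqrt_mult exp_double)
    finally show "1 / sqrt (1 - \<theta>\<^sup>2 * \<rho>\<^sup>2) \<le> exp (\<theta>\<^sup>2 * \<rho>\<^sup>2)"
      using y unfolding y_def[symmetric] by (simp add: field_simps)
  qed
  finally show ?thesis by (simp add: \<rho>_def)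
qed

section \<open>The operator norm and its measurability\<close>

lemma scalar_prod_eq_dot:
  "dim_vec y = p \<Longrightarrow> scalar_prod x y = dot {..<p} (vec_index x) (vec_index y)"
  by (simp add: scalar_prod_def dot_def lessThan_atLeast0)

lemma vec_norm2_eq_L2_set: "vec_norm2 v = L2_set (vec_index v) {..<dim_vec v}"
  by (simp add: vec_norm2_def L2_set_def scalar_prod_def power2_eq_square lessThan_atLeast0)

lemma vec_norm2_triangle:
  assumes "x \<in> carrier_vec p" "y \<in> carrier_vec p"
  shows "vec_norm2 (x + y) \<le> vec_norm2 x + vec_norm2 y"
proof -
  have "vec_norm2 (x + y) = L2_set (\<lambda>i. vec_index x i + vec_index y i) {..<p}"
    unfolding vec_norm2_eq_L2_set using assms by (intro L2_set_cong) auto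
  then show ?thesis
    using L2_set_triangle_ineq[of "vec_index x" "vec_index y" "{..<p}"] assms
    by (simp add: vec_norm2_eq_L2_set)
qed

lemma vec_norm2_minus_triangle:
  assumes "x \<in> carrier_vec p" "y \<in> carrier_vec p"
  shows "vec_norm2 (x - y) \<le> vec_norm2 x + vec_norm2 y"
proof -
  have "vec_norm2 (- y) = vec_norm2 y"
    using assms unfolding vec_norm2_eq_L2_set L2_set_def by (auto intro!: sum.cong)
  moreover have "x - y = x + (- y)" using assms by auto
  ultimately show ?thesis using vec_norm2_triangle[of x p "- y"] assms by simp
qed

text \<open>
A crude norm that dominates the operator norm and is visibly continuous in the entries.
\<close>

definition entry_sum :: "real Matrix.mat \<Rightarrow> real" where
  "entry_sum A = (\<Sum>i<dim_row A. \<Sum>j<dim_col A. \<bar>A $$ (i, j)\<bar>)"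

lemma vec_norm2_mult_le_entry_sum:
  assumes "v \<in> carrier_vec (dim_col A)" "vec_norm2 v \<le> 1"
  shows "vec_norm2 (A *\<^sub>v v) \<le> entry_sum A"
proof -
  have v1: "\<bar>vec_index v j\<bar> \<le> 1" if "j < dim_col A" for j
  proof -
    have "\<bar>vec_index v j\<bar> \<le> L2_set (\<lambda>j. \<bar>vec_index v j\<bar>) {..<dim_col A}"
      using that by (intro member_le_L2_set) auto
    also have "\<dots> = vec_norm2 v"
      using assms by (simp add: vec_norm2_eq_L2_set L2_set_def)
    finally show ?thesis using assms by simp
  qed
  have "vec_norm2 (A *\<^sub>v v) \<le> (\<Sum>i<dim_row A. \<bar>vec_index (A *\<^sub>v v) i\<bar>)"
    unfolding vec_norm2_eq_L2_set dim_mult_mat_vec by (rule L2_set_le_sum_abs)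
  also have "\<dots> \<le> (\<Sum>i<dim_row A. \<Sum>j<dim_col A. \<bar>A $$ (i, j)\<bar>)"
  proof (rule sum_mono)
    fix i assume "i \<in> {..<dim_row A}"
    then have "\<bar>vec_index (A *\<^sub>v v) i\<bar> = \<bar>\<Sum>j<dim_col A. A $$ (i, j) * vec_index v j\<bar>"
      using assms by (simp add: scalar_prod_def lessThan_atLeast0)
    also have "\<dots> \<le> (\<Sum>j<dim_col A. \<bar>A $$ (i, j) * vec_index v j\<bar>)" by (rule sum_abs)
    also have "\<dots> \<le> (\<Sum>j<dim_col A. \<bar>A $$ (i, j)\<bar>)"
      using v1 by (intro sum_mono) (auto simp: abs_mult intro: mult_left_le)
    finally show "\<bar>vec_index (A *\<^sub>v v) i\<bar> \<le> (\<Sum>j<dim_col A. \<bar>A $$ (i, j)\<bar>)" .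
  qed
  finally show ?thesis by (simp add: entry_sum_def)
qed

lemma vec_norm2_mult_le_op_norm:
  assumes "v \<in> carrier_vec (dim_col A)" "vec_norm2 v \<le> 1"
  shows "vec_norm2 (A *\<^sub>v v) \<le> op_norm A"
  unfolding op_norm_def
  using assms vec_norm2_mult_le_entry_sum
  by (intro cSUP_upper bdd_aboveI2[where M = "entry_sum A"]) auto

lemma op_norm_le_add_entry_sum:
  assumes "A \<in> carrier_mat p q" "B \<in> carrier_mat p q"
  shows "op_norm A \<le> op_norm B + entry_sum (A - B)"
  unfolding op_norm_def[of A]
proof (rule cSUP_least)
  have "vec_norm2 (0\<^sub>v (dim_col A)) \<le> 1" by (simp add: vec_norm2_eq_L2_set L2_set_0')
  then show "{v \<in> carrier_vec (dim_col A). vec_norm2 v \<le> 1} \<noteq> {}"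
    by (auto intro!: exI[of _ "0\<^sub>v (dim_col A)"])
next
  fix v assume v: "v \<in> {v \<in> carrier_vec (dim_col A). vec_norm2 v \<le> 1}"
  have c: "v \<in> carrier_vec q" using v assms by auto
  have "A *\<^sub>v v = B *\<^sub>v v + (A - B) *\<^sub>v v"
    using minus_mult_distrib_mat_vec[OF assms c] mult_mat_vec_carrier[OF assms(1) c]
      mult_mat_vec_carrier[OF assms(2) c] assms by (intro eq_vecI) auto
  then have "vec_norm2 (A *\<^sub>v v) \<le> vec_norm2 (B *\<^sub>v v) + vec_norm2 ((A - B) *\<^sub>v v)"
    using vec_norm2_triangle[of "B *\<^sub>v v" p "(A - B) *\<^sub>v v"] assms(2) c
      mult_mat_vec_carrier[OF minus_carrier_mat[OF assms(2)] c] by simp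
  also have "\<dots> \<le> op_norm B + entry_sum (A - B)"
    using v assms by (intro add_mono vec_norm2_mult_le_op_norm vec_norm2_mult_le_entry_sum) auto
  finally show "vec_norm2 (A *\<^sub>v v) \<le> op_norm B + entry_sum (A - B)" .
qed

text \<open>
The operator norm is Lipschitz with respect to \<open>entry_sum\<close>. The matrix is parametrised by a function
on index pairs so that continuity, and hence Borel measurability, refers to the product topology.
\<close>

lemma continuous_on_op_norm_entries:
  "continuous_on UNIV (\<lambda>a. op_norm (Matrix.mat p p a))"
proof -
  let ?f = "\<lambda>a. op_norm (Matrix.mat p p a)"
  have lip: "\<bar>?f b - ?f a\<bar> \<le> (\<Sum>i<p. \<Sum>j<p. \<bar>b (i, j) - a (i, j)\<bar>)" for a b
  proof -
    have "entry_sum (Matrix.mat p p b - Matrix.mat p p a) = (\<Sum>i<p. \<Sum>j<p. \<bar>b (i, j) - a (i, j)\<bar>)"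
      "entry_sum (Matrix.mat p p a - Matrix.mat p p b) = (\<Sum>i<p. \<Sum>j<p. \<bar>b (i, j) - a (i, j)\<bar>)"
      by (simp_all add: entry_sum_def abs_minus_commute)
    then show ?thesis
      using op_norm_le_add_entry_sum[of "Matrix.mat p p a" p p "Matrix.mat p p b"]
        op_norm_le_add_entry_sum[of "Matrix.mat p p b" p p "Matrix.mat p p a"] by simp
  qed
  show ?thesis
  proof (clarsimp simp: continuous_on_eq_continuous_at isCont_def)
    fix a :: "nat \<times> nat \<Rightarrow> real"
    let ?g = "\<lambda>b. \<Sum>i<p. \<Sum>j<p. \<bar>b (i, j) - a (i, j)\<bar>"
    have "continuous_on UNIV ?g" by (intro continuous_intros) auto
    then have "isCont ?g a" by (simp add: continuous_on_eq_continuous_at)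
    then have "?g \<midarrow>a\<rightarrow> 0" by (simp add: isCont_def)
    then have "(\<lambda>b. ?f b - ?f a) \<midarrow>a\<rightarrow> 0"
      by (rule Lim_null_comparison[rotated]) (auto intro!: always_eventually simp: lip)
    then show "?f \<midarrow>a\<rightarrow> ?f a" by (rule LIM_zero_cancel)
  qed
qed

text \<open>
The measure of a nonmeasurable set is zero by convention, so the lower bound depends on the error
event being measurable.
\<close>

lemma op_norm_estimation_error_measurable:
  assumes T: "T \<in> estimators n p" and \<Sigma>: "\<Sigma> \<in> carrier_mat p p"
  shows "(\<lambda>X. op_norm (T X - \<Sigma>)) \<in> borel_measurable (sample_space n p)"
proof -
  let ?e = "\<lambda>X (ij :: nat \<times> nat). if fst ij < p \<and> snd ij < p then T X $$ ij - \<Sigma> $$ ij else 0"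
  have "(\<lambda>X. ?e X ij) \<in> borel_measurable (sample_space n p)" for ij
  proof (cases ij)
    case (Pair i j)
    show ?thesis
    proof (cases "i < p \<and> j < p")
      case True
      then have "(\<lambda>X. T X $$ (i, j)) \<in> borel_measurable (sample_space n p)"
        using T by (auto simp: estimators_def)
      from borel_measurable_diff[OF this borel_measurable_const[of "\<Sigma> $$ (i, j)"]]
      show ?thesis using True Pair by simp
    qed (auto simp: Pair)
  qed
  then have "?e \<in> borel_measurable (sample_space n p)"
    by (rule measurable_coordinatewise_then_product)
  then have "(\<lambda>X. op_norm (Matrix.mat p p (?e X))) \<in> borel_measurable (sample_space n p)"
    by (rule measurable_compose)
       (rule borel_measurable_continuous_onI[OF continuous_on_op_norm_entries])
  also have "(\<lambda>X. op_norm (Matrix.mat p p (?e X))) \<in> borel_measurable (sample_space n p) \<longleftrightarrow> ?thesis"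
  proof (rule measurable_cong)
    fix X assume "X \<in> space (sample_space n p)"
    then have "T X \<in> carrier_mat p p" using T by (auto simp: estimators_def)
    then have "Matrix.mat p p (?e X) = T X - \<Sigma>" using \<Sigma> by (intro eq_matI) auto
    then show "op_norm (Matrix.mat p p (?e X)) = op_norm (T X - \<Sigma>)" by simp
  qed
  finally show ?thesis .
qed

section \<open>Uniqueness of the positive semidefinite square root\<close>

lemma psd_mats_dest:
  assumes "A \<in> psd_mats p"
  shows "A \<in> carrier_mat p p" "transpose_mat A = A"
    "\<And>v. v \<in> carrier_vec p \<Longrightarrow> 0 \<le> scalar_prod v (A *\<^sub>v v)"
  using assms by (auto simp: psd_mats_def)

lemma scalar_prod_self_eq_0:
  assumes "x \<in> carrier_vec p" "scalar_prod x x = (0 :: real)"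
  shows "x = 0\<^sub>v p"
proof (rule eq_vecI)
  fix i assume "i < dim_vec (0\<^sub>v p)"
  then show "vec_index x i = vec_index (0\<^sub>v p) i"
    using assms by (simp add: scalar_prod_def sum_nonneg_eq_0_iff)
qed (use assms in auto)

lemma scalar_prod_self_nonneg: "0 \<le> scalar_prod x (x :: real Matrix.vec)"
  by (simp add: scalar_prod_def sum_nonneg)

text \<open>
With \<open>y = A x\<close> the quadratic form at \<open>x - t y\<close> equals \<open>- 2 t |y|\<^sup>2 + t\<^sup>2 \<langle>y, A y\<rangle>\<close>, which would be
negative for small \<open>t > 0\<close> unless \<open>y = 0\<close>. The choice \<open>t = q / (r + 1)\<close> below is small enough.
\<close>

lemma psd_quadratic_form_zero:
  assumes A: "A \<in> psd_mats p" and x: "x \<in> carrier_vec p" and 0: "scalar_prod x (A *\<^sub>v x) = 0"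
  shows "A *\<^sub>v x = 0\<^sub>v p"
proof (rule scalar_prod_self_eq_0)
  note c = psd_mats_dest[OF A]
  define y where "y = A *\<^sub>v x"
  have y: "y \<in> carrier_vec p" using c x by (simp add: y_def)
  have Ay: "A *\<^sub>v y \<in> carrier_vec p" using c y by simp
  define q where "q = scalar_prod y y"
  define r where "r = scalar_prod y (A *\<^sub>v y)"
  have r: "r \<ge> 0" using c(3)[OF y] by (simp add: r_def)
  have xy: "scalar_prod x (A *\<^sub>v y) = q"
    using transpose_vec_mult_scalar[OF c(1) y x] c(2) by (simp add: q_def y_def)
  define t where "t = q / (r + 1)"
  have "A *\<^sub>v (x - t \<cdot>\<^sub>v y) = y - t \<cdot>\<^sub>v (A *\<^sub>v y)"
    using mult_minus_distrib_mat_vec[OF c(1) x, of "t \<cdot>\<^sub>v y"] mult_mat_vec[OF c(1) y] y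
    by (simp add: y_def)
  then have "scalar_prod (x - t \<cdot>\<^sub>v y) (A *\<^sub>v (x - t \<cdot>\<^sub>v y)) =
      scalar_prod x y - t * scalar_prod x (A *\<^sub>v y) - t * (q - t * r)"
    using x y Ay
    by (simp add: minus_scalar_prod_distrib[where n = p] scalar_prod_minus_distrib[where n = p] q_def r_def)
       (simp add: algebra_simps)
  also have "\<dots> = t * (t * r - 2 * q)"
    using 0 unfolding xy by (simp add: y_def algebra_simps)
  finally have ge: "0 \<le> t * (t * r - 2 * q)"
    using c(3)[of "x - t \<cdot>\<^sub>v y"] x y by simp
  have "t * r - 2 * q = - q * (r + 2) / (r + 1)" using r by (simp add: t_def field_simps)
  then have "0 \<le> - (q * q * (r + 2)) / ((r + 1) * (r + 1))"
    using ge by (simp add: t_def)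
  moreover have "(r + 1) * (r + 1) > 0" using r by simp
  ultimately have "q * q * (r + 2) \<le> 0"
    by (simp only: minus_divide_left zero_le_divide_iff) linarith
  then show "scalar_prod (A *\<^sub>v x) (A *\<^sub>v x) = 0"
    using r by (auto simp: mult_le_0_iff q_def y_def)
qed (use assms in \<open>auto simp: psd_mats_def\<close>)

text \<open>
For \<open>D = B - C\<close> the hypothesis gives \<open>B D + D C = 0\<close>, so \<open>tr (D B D) + tr (D C D) = 0\<close>. Both traces
are sums of nonnegative quadratic forms at the columns of \<open>D\<close>. All of these therefore vanish, \<open>B\<close>
and \<open>C\<close> annihilate the columns of \<open>D\<close>, and \<open>D\<^sup>2 = 0\<close> forces the symmetric matrix \<open>D\<close> to be zero.
\<close>

lemma psd_square_injective:
  assumes B: "B \<in> psd_mats p" and C: "C \<in> psd_mats p" and eq: "B * B = C * C"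
  shows "B = C"
proof -
  note b = psd_mats_dest[OF B] and c = psd_mats_dest[OF C]
  define D where "D = B - C"
  have D: "D \<in> carrier_mat p p" unfolding D_def using c(1) by (rule minus_carrier_mat)
  have Dt: "transpose_mat D = D"
    unfolding D_def using b c transpose_minus[of B p p C] by simp
  have DC: "D * C \<in> carrier_mat p p" "B * D \<in> carrier_mat p p" "C * D \<in> carrier_mat p p"
    using D b c by auto
  have sum0: "B * D + D * C = 0\<^sub>m p p"
  proof -
    have "B * D = B * B - B * C" unfolding D_def using b c by (simp add: mult_minus_distrib_mat)
    moreover have "D * C = B * C - C * C" unfolding D_def using b c by (simp add: minus_mult_distrib_mat)
    ultimately show ?thesis using eq b c by (intro eq_matI) auto
  qed
  define q where "q = (\<lambda>E j. scalar_prod (col D j) (E *\<^sub>v col D j))"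
  have entry: "(D * (E * D)) $$ (j, j) = q E j" if "j < p" "E \<in> carrier_mat p p" for E j
  proof -
    have "row D j = col D j" using Dt D that by (metis carrier_matD(2) row_transpose)
    moreover have "col (E * D) j = E *\<^sub>v col D j" using that D by (intro eq_vecI) auto
    ultimately show ?thesis using that D by (simp add: q_def)
  qed
  \<comment> \<open>The sum of both families of quadratic forms is \<open>tr (D B D) + tr (D C D)\<close>; cyclicity of
     the trace turns the second term into \<open>tr (D D C)\<close>, and then \<open>sum0\<close> applies.\<close>
  have "(\<Sum>j<p. q B j + q C j) = (\<Sum>j<p. (D * (B * D)) $$ (j, j)) + (\<Sum>j<p. (D * (C * D)) $$ (j, j))"
    using b c by (simp add: sum.distrib entry)
  also have "(\<Sum>j<p. (D * (C * D)) $$ (j, j)) = (\<Sum>j<p. (D * (D * C)) $$ (j, j))"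
  proof -
    have "(\<Sum>j<p. (D * (C * D)) $$ (j, j)) = (\<Sum>j<p. ((D * C) * D) $$ (j, j))"
      using D c by (simp add: assoc_mult_mat[OF D c(1) D])
    also have "\<dots> = (\<Sum>j<p. \<Sum>k<p. (D * C) $$ (j, k) * D $$ (k, j))"
      using D DC(1) by (intro sum.cong)
        (auto simp: scalar_prod_def lessThan_atLeast0 simp del: assoc_mult_mat)
    also have "\<dots> = (\<Sum>k<p. \<Sum>j<p. D $$ (k, j) * (D * C) $$ (j, k))"
      by (subst sum.swap) (simp add: mult.commute)
    also have "\<dots> = (\<Sum>k<p. (D * (D * C)) $$ (k, k))"
      using D DC(1) by (intro sum.cong)
        (auto simp: scalar_prod_def lessThan_atLeast0 simp del: assoc_mult_mat)
    finally show ?thesis .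
  qed
  also have "(\<Sum>j<p. (D * (B * D)) $$ (j, j)) + (\<Sum>j<p. (D * (D * C)) $$ (j, j)) =
      (\<Sum>j<p. (D * (B * D + D * C)) $$ (j, j))"
    using D DC b c by (simp add: mult_add_distrib_mat[OF D DC(2) DC(1)] sum.distrib)
  also have "\<dots> = 0" unfolding sum0 using D by (simp add: right_mult_zero_mat[OF D])
  finally have "(\<Sum>j<p. q B j + q C j) = 0" .
  moreover have q0: "q B j \<ge> 0" "q C j \<ge> 0" if "j < p" for j
    using b(3)[of "col D j"] c(3)[of "col D j"] D by (auto simp: q_def)
  ultimately have "\<forall>j<p. q B j + q C j = 0"
    by (subst (asm) sum_nonneg_eq_0_iff) (auto simp: add_nonneg_nonneg)
  then have z: "q B j = 0" "q C j = 0" if "j < p" for j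
    using q0[OF that] that by (auto simp: add_nonneg_eq_0_iff)
  have col0: "col D j = 0\<^sub>v p" if "j < p" for j
  proof (rule scalar_prod_self_eq_0)
    have cj: "col D j \<in> carrier_vec p" using D by auto
    have "B *\<^sub>v col D j = 0\<^sub>v p" "C *\<^sub>v col D j = 0\<^sub>v p"
      using psd_quadratic_form_zero[OF B cj] psd_quadratic_form_zero[OF C cj] z[OF that]
      by (auto simp: q_def)
    then have "D *\<^sub>v col D j = 0\<^sub>v p"
      unfolding D_def using minus_mult_distrib_mat_vec[OF b(1) c(1), of "col (B - C) j"] cj
      by (simp add: D_def)
    then have "vec_index (D *\<^sub>v col D j) j = 0" using that by simp
    moreover have "row D j = col D j" using Dt D that by (metis carrier_matD(2) row_transpose)
    ultimately show "scalar_prod (col D j) (col D j) = 0" using that D by simp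
  qed (use D in auto)
  show "B = C"
  proof (rule eq_matI)
    fix i j assume "i < dim_row C" "j < dim_col C"
    then have "D $$ (i, j) = 0" using col0[of j] D c
      by (metis carrier_matD index_col index_zero_vec(1))
    then show "B $$ (i, j) = C $$ (i, j)"
      using \<open>i < dim_row C\<close> \<open>j < dim_col C\<close> b c by (simp add: D_def)
  qed (use b c in auto)
qed

lemma psd_sqrt_eqI:
  assumes "B \<in> psd_mats p" "B * B = A"
  shows "psd_sqrt p A = B"
  unfolding psd_sqrt_def using assms psd_square_injective by (intro the_equality) auto

section \<open>Spiked covariance matrices\<close>

definition spiked :: "nat \<Rightarrow> real \<Rightarrow> real \<Rightarrow> (nat \<Rightarrow> real) \<Rightarrow> real Matrix.mat" where
  "spiked p a \<theta> v = Matrix.mat p p (\<lambda>(i, j). a * ((if i = j then 1 else 0) + \<theta> * v i * v j))"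

lemma spiked_carrier [simp]: "spiked p a \<theta> v \<in> carrier_mat p p"
  "dim_row (spiked p a \<theta> v) = p" "dim_col (spiked p a \<theta> v) = p"
  by (auto simp: spiked_def)

lemma transpose_spiked: "transpose_mat (spiked p a \<theta> v) = spiked p a \<theta> v"
  by (intro eq_matI) (auto simp: spiked_def)

lemma spiked_mult_vec:
  assumes "x \<in> carrier_vec p" "i < p"
  shows "vec_index (spiked p a \<theta> v *\<^sub>v x) i = a * (vec_index x i + \<theta> * dot {..<p} v (vec_index x) * v i)"
proof -
  have "vec_index (spiked p a \<theta> v *\<^sub>v x) i =
      (\<Sum>j<p. a * ((if i = j then 1 else 0) + \<theta> * v i * v j) * vec_index x j)"
    using assms by (simp add: spiked_def scalar_prod_def lessThan_atLeast0)
  also have "\<dots> = (\<Sum>j<p. (if i = j then a * vec_index x j else 0) + a * \<theta> * v i * (v j * vec_index x j))"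
    by (intro sum.cong) (auto simp: algebra_simps)
  also have "\<dots> = a * vec_index x i + a * \<theta> * v i * dot {..<p} v (vec_index x)"
    using assms by (simp add: sum.distrib dot_def sum_distrib_left)
  finally show ?thesis by (simp add: algebra_simps)
qed

lemma spiked_mult_spiked:
  assumes v: "dot {..<p} v v = 1"
  shows "spiked p a \<theta> v * spiked p b \<eta> v = spiked p (a * b) ((1 + \<theta>) * (1 + \<eta>) - 1) v"
proof (rule eq_matI)
  fix i j assume "i < dim_row (spiked p (a * b) ((1 + \<theta>) * (1 + \<eta>) - 1) v)"
    "j < dim_col (spiked p (a * b) ((1 + \<theta>) * (1 + \<eta>) - 1) v)"
  then have ij: "i < p" "j < p" by auto
  have col: "vec_index (col (spiked p b \<eta> v) j) k = b * ((if k = j then 1 else 0) + \<eta> * v k * v j)" if "k < p" for k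
    using that ij by (simp add: spiked_def)
  have "dot {..<p} v (vec_index (col (spiked p b \<eta> v) j)) =
      (\<Sum>k<p. (if k = j then b * v k else 0) + b * \<eta> * v j * (v k * v k))"
    unfolding dot_def using col by (intro sum.cong) (auto simp: algebra_simps)
  also have "\<dots> = b * v j + b * \<eta> * v j * dot {..<p} v v"
    using ij by (simp add: sum.distrib dot_def sum_distrib_left)
  finally have d: "dot {..<p} v (vec_index (col (spiked p b \<eta> v) j)) = b * (1 + \<eta>) * v j"
    using v by (simp add: algebra_simps)
  have "(spiked p a \<theta> v * spiked p b \<eta> v) $$ (i, j) = vec_index (spiked p a \<theta> v *\<^sub>v col (spiked p b \<eta> v) j) i"
    using ij by simp
  also have "\<dots> = a * (b * ((if i = j then 1 else 0) + \<eta> * v i * v j) + \<theta> * (b * (1 + \<eta>) * v j) * v i)"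
    using ij by (subst spiked_mult_vec) (auto simp only: d col intro!: carrier_vecI, simp)
  also have "\<dots> = spiked p (a * b) ((1 + \<theta>) * (1 + \<eta>) - 1) v $$ (i, j)"
    using ij by (simp add: spiked_def algebra_simps)
  finally show "(spiked p a \<theta> v * spiked p b \<eta> v) $$ (i, j) =
    spiked p (a * b) ((1 + \<theta>) * (1 + \<eta>) - 1) v $$ (i, j)" .
qed auto

lemma spiked_quadratic_form:
  assumes "x \<in> carrier_vec p"
  shows "scalar_prod x (spiked p a \<theta> v *\<^sub>v x) =
    a * (dot {..<p} (vec_index x) (vec_index x) + \<theta> * (dot {..<p} v (vec_index x))\<^sup>2)"
proof -
  have "scalar_prod x (spiked p a \<theta> v *\<^sub>v x) =
      (\<Sum>i<p. vec_index x i * (a * (vec_index x i + \<theta> * dot {..<p} v (vec_index x) * v i)))"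
    using assms by (subst scalar_prod_eq_dot[where p = p])
      (auto simp: dot_def[of _ "vec_index x" "vec_index (spiked p a \<theta> v *\<^sub>v x)"] spiked_mult_vec
        intro!: sum.cong simp del: index_mult_mat_vec)
  also have "\<dots> = (\<Sum>i<p. a * (vec_index x i * vec_index x i) +
      a * \<theta> * dot {..<p} v (vec_index x) * (v i * vec_index x i))"
    by (intro sum.cong) (auto simp: algebra_simps)
  also have "\<dots> = a * dot {..<p} (vec_index x) (vec_index x) +
      a * \<theta> * dot {..<p} v (vec_index x) * dot {..<p} v (vec_index x)"
    by (simp add: sum.distrib dot_def sum_distrib_left)
  finally show ?thesis by (simp add: algebra_simps power2_eq_square)
qed

lemma spiked_psd:
  assumes v: "dot {..<p} v v = 1" and "a \<ge> 0" "\<theta> \<ge> -1"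
  shows "spiked p a \<theta> v \<in> psd_mats p"
  unfolding psd_mats_def
proof (safe intro!: spiked_carrier transpose_spiked)
  fix x :: "real Matrix.vec" assume x: "x \<in> carrier_vec p"
  have le: "(dot {..<p} v (vec_index x))\<^sup>2 \<le> dot {..<p} (vec_index x) (vec_index x)"
    using dot_Cauchy_Schwarz[of "{..<p}" v "vec_index x"] v by simp
  have "- 1 * (dot {..<p} v (vec_index x))\<^sup>2 \<le> \<theta> * (dot {..<p} v (vec_index x))\<^sup>2"
    using assms by (intro mult_right_mono) auto
  then show "0 \<le> scalar_prod x (spiked p a \<theta> v *\<^sub>v x)"
    unfolding spiked_quadratic_form[OF x] using le \<open>a \<ge> 0\<close> by (intro mult_nonneg_nonneg) auto
qed

lemma psd_sqrt_spiked:
  assumes v: "dot {..<p} v v = 1" and "a \<ge> 0" "\<theta> \<ge> -1"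
  shows "psd_sqrt p (spiked p a \<theta> v) = spiked p (sqrt a) (sqrt (1 + \<theta>) - 1) v"
  using assms by (intro psd_sqrt_eqI spiked_psd) (auto simp: spiked_mult_spiked)

text \<open>
On an eigenvector \<open>x\<close> of the squared matrix with eigenvalue \<open>k\<close>, the value \<open>k |x|\<^sup>2\<close> is the weighted sum
of \<open>a\<^sup>2\<close> and \<open>(a (1 + \<theta>))\<^sup>2\<close> with weights \<open>|x|\<^sup>2 - \<langle>v, x\<rangle>\<^sup>2\<close> and \<open>\<langle>v, x\<rangle>\<^sup>2\<close>. The vector \<open>v\<close> is an
eigenvector itself, so the maximum is taken over a nonempty set.
\<close>

lemma s_max_spiked:
  assumes v: "dot {..<p} v v = 1" and a: "a \<ge> 0" "a \<le> M" and \<theta>: "\<theta> \<ge> -1" "a * (1 + \<theta>) \<le> M"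
  shows "s_max (spiked p a \<theta> v) \<le> M"
proof -
  define A where "A = spiked p a \<theta> v"
  define \<eta> where "\<eta> = (1 + \<theta>) * (1 + \<theta>) - 1"
  have AA: "transpose_mat A * A = spiked p (a * a) \<eta> v"
    unfolding A_def transpose_spiked \<eta>_def by (rule spiked_mult_spiked[OF v])
  let ?S = "spectrum (transpose_mat A * A)"
  have fin: "finite ?S" unfolding AA by (rule card_finite_spectrum[OF spiked_carrier(1)])
  have "eigenvector (spiked p (a * a) \<eta> v) (Matrix.vec p v) (a * a * (1 + \<eta>))"
    unfolding eigenvector_def
  proof (intro conjI notI)
    assume "Matrix.vec p v = 0\<^sub>v (dim_row (spiked p (a * a) \<eta> v))"
    then have "v i = 0" if "i < p" for i
      using that by (metis index_vec index_zero_vec(1) spiked_carrier(2))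
    then have "dot {..<p} v v = 0" by (simp add: dot_def)
    then show False using v by simp
  next
    have "dot {..<p} v (vec_index (Matrix.vec p v)) = dot {..<p} v v"
      unfolding dot_def by (intro sum.cong) auto
    then show "spiked p (a * a) \<eta> v *\<^sub>v Matrix.vec p v = a * a * (1 + \<eta>) \<cdot>\<^sub>v Matrix.vec p v"
      using v by (intro eq_vecI) (auto simp: spiked_mult_vec algebra_simps simp del: index_mult_mat_vec)
  qed auto
  then have ne: "?S \<noteq> {}" unfolding AA spectrum_def eigenvalue_def by auto
  have "sqrt k \<le> M" if k: "k \<in> ?S" for k
  proof -
    obtain x where x: "x \<in> carrier_vec p" "x \<noteq> 0\<^sub>v p" "spiked p (a * a) \<eta> v *\<^sub>v x = k \<cdot>\<^sub>v x"
      using k by (auto simp: AA spectrum_def eigenvalue_def eigenvector_def)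
    let ?n = "dot {..<p} (vec_index x) (vec_index x)" and ?q = "(dot {..<p} v (vec_index x))\<^sup>2"
    have q: "?q \<le> ?n" using dot_Cauchy_Schwarz[of "{..<p}" v "vec_index x"] v by simp
    have "?n \<noteq> 0" "?n \<ge> 0"
      using scalar_prod_self_eq_0[OF x(1)] x scalar_prod_self_nonneg[of x]
      by (auto simp: scalar_prod_eq_dot[symmetric])
    then have n: "?n > 0" by simp
    have "k * ?n = a * a * (?n + \<eta> * ?q)"
      using spiked_quadratic_form[OF x(1), of "a * a" \<eta> v] x
      by (simp add: scalar_prod_eq_dot[symmetric])
    also have "\<dots> = a\<^sup>2 * (?n - ?q) + (a * (1 + \<theta>))\<^sup>2 * ?q"
      by (simp add: \<eta>_def algebra_simps power2_eq_square)
    also have "\<dots> \<le> M\<^sup>2 * (?n - ?q) + M\<^sup>2 * ?q"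
      using q a \<theta> by (intro add_mono mult_right_mono power_mono) auto
    also have "\<dots> = M\<^sup>2 * ?n" by (simp add: algebra_simps)
    finally have "k \<le> M\<^sup>2" using n by simp
    then have "sqrt k \<le> sqrt (M\<^sup>2)" by (rule real_sqrt_le_mono)
    then show ?thesis using a by simp
  qed
  then show ?thesis
    unfolding s_max_def singular_values_def A_def[symmetric]
    using fin ne by (intro Max.boundedI) auto
qed

lemma spiked_in_F_bounded:
  assumes v: "dot {..<p} v v = 1" and a: "a \<ge> 0" "a \<le> M" and \<theta>: "\<theta> \<ge> -1" "a * (1 + \<theta>) \<le> M"
    and s: "card {i. i < p \<and> v i \<noteq> 0} \<le> s"
  shows "spiked p a \<theta> v \<in> F_bounded p s M"
proof -
  let ?S = "{i. i < p \<and> v i \<noteq> 0}"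
  have "spiked p a \<theta> v - mat_diag p (\<lambda>i. spiked p a \<theta> v $$ (i, i)) \<in> G_supp p ?S"
    unfolding G_supp_def by (auto simp: spiked_def mat_diag_def)
  then have "spiked p a \<theta> v - mat_diag p (\<lambda>i. spiked p a \<theta> v $$ (i, i)) \<in> G_sparse p s"
    unfolding G_sparse_def using s by (intro UN_I[of ?S]) auto
  then show ?thesis
    using spiked_psd[OF v a(1) \<theta>(1)] s_max_spiked[OF v a \<theta>]
    by (simp add: F_bounded_def F_sparse_def)
qed

text \<open>
Every \<open>v\<close> describes the same matrix \<open>a I\<close> at \<open>\<theta> = 0\<close>, so one null hypothesis serves all directions.
\<close>

lemma spiked_0: "spiked p a 0 v = spiked p a 0 w"
  by (simp add: spiked_def)

text \<open>
The two differences are compared on the single vector \<open>v\<close>, on which they differ by \<open>a \<theta> v\<close>.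
\<close>

lemma op_norm_spike_separation:
  assumes v: "dot {..<p} v v = 1" and T: "T \<in> carrier_mat p p"
  shows "a * \<bar>\<theta>\<bar> \<le> op_norm (T - spiked p a 0 v) + op_norm (T - spiked p a \<theta> v)"
proof -
  let ?v = "Matrix.vec p v" and ?A = "T - spiked p a 0 v" and ?B = "T - spiked p a \<theta> v"
  have dv: "dot {..<p} v (vec_index ?v) = 1" "dot {..<p} (vec_index ?v) (vec_index ?v) = 1"
    using v unfolding dot_def by (auto intro!: trans[OF sum.cong v[unfolded dot_def]])
  have n1: "vec_norm2 ?v = 1"
    by (simp add: vec_norm2_def scalar_prod_eq_dot[where p = p] dv)
  have c: "?A \<in> carrier_mat p p" "?B \<in> carrier_mat p p" using T by (auto intro!: minus_carrier_mat)
  have cv: "T *\<^sub>v ?v \<in> carrier_vec p" using T by simp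
  have "?A *\<^sub>v ?v - ?B *\<^sub>v ?v = a * \<theta> \<cdot>\<^sub>v ?v"
    using minus_mult_distrib_mat_vec[OF T spiked_carrier(1)[of p a 0 v], of ?v]
      minus_mult_distrib_mat_vec[OF T spiked_carrier(1)[of p a \<theta> v], of ?v] T
    by (intro eq_vecI) (auto simp: spiked_mult_vec dv algebra_simps simp del: index_mult_mat_vec)
  moreover have "vec_norm2 (a * \<theta> \<cdot>\<^sub>v ?v) = \<bar>a * \<theta>\<bar>"
  proof -
    have "scalar_prod (a * \<theta> \<cdot>\<^sub>v ?v) (a * \<theta> \<cdot>\<^sub>v ?v) = (a * \<theta>)\<^sup>2 * scalar_prod ?v ?v"
      by (simp add: power2_eq_square)
    then show ?thesis
      by (simp add: vec_norm2_def scalar_prod_eq_dot[where p = p] dv(2))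
  qed
  ultimately have "\<bar>a * \<theta>\<bar> \<le> vec_norm2 (?A *\<^sub>v ?v) + vec_norm2 (?B *\<^sub>v ?v)"
    using vec_norm2_minus_triangle[of "?A *\<^sub>v ?v" p "?B *\<^sub>v ?v"] c by simp
  also have "\<dots> \<le> op_norm ?A + op_norm ?B"
    using c n1 by (intro add_mono vec_norm2_mult_le_op_norm) auto
  finally show ?thesis
    using mult_right_mono[OF abs_ge_self[of a], of "\<bar>\<theta>\<bar>"] by (simp add: abs_mult)
qed

section \<open>Densities of the contaminated laws\<close>

definition white_noise :: "nat \<Rightarrow> real \<Rightarrow> (nat \<Rightarrow> real) measure" where
  "white_noise p a = distr (std_gaussian {..<p}) (euclidean_borel p) (\<lambda>z. \<lambda>i\<in>{..<p}. sqrt a * z i)"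

lemma scaling_measurable:
  fixes c :: real
  shows "(\<lambda>z. \<lambda>i\<in>{..<p}. c * z i) \<in> measurable (PiM {..<p} (\<lambda>_. borel)) (euclidean_borel p)"
  unfolding euclidean_borel_def by (intro measurable_restrict borel_measurable_times) auto

lemma sets_white_noise: "sets (white_noise p a) = sets (euclidean_borel p)"
  by (simp add: white_noise_def)

lemma prob_space_white_noise: "prob_space (white_noise p a)"
  unfolding white_noise_def
  using scaling_measurable[where c = "sqrt a" and p = p]
  by (intro prob_space.prob_space_distr prob_space_std_gaussian)
     (simp add: measurable_cong_sets[OF sets_std_gaussian refl])

lemma nn_integral_white_noise:
  assumes "F \<in> borel_measurable (euclidean_borel p)"
  shows "(\<integral>\<^sup>+y. F y \<partial>white_noise p a) = (\<integral>\<^sup>+z. F (\<lambda>i\<in>{..<p}. sqrt a * z i) \<partial>std_gaussian {..<p})"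
  unfolding white_noise_def
  using assms scaling_measurable[where c = "sqrt a" and p = p]
  by (intro nn_integral_distr) (simp_all add: measurable_cong_sets[OF sets_std_gaussian refl])

text \<open>
The density of \<open>N(0, a (I + \<theta> v v\<^sup>T))\<close> with respect to \<open>N(0, a I)\<close>, obtained from
\<open>spike_density\<close> by rescaling the observation.
\<close>

definition spike_likelihood :: "nat \<Rightarrow> real \<Rightarrow> real \<Rightarrow> (nat \<Rightarrow> real) \<Rightarrow> (nat \<Rightarrow> real) \<Rightarrow> ennreal" where
  "spike_likelihood p a \<theta> v y = ennreal (spike_density {..<p} \<theta> v (\<lambda>i\<in>{..<p}. y i / sqrt a))"

lemma spike_likelihood_measurable [measurable]:
  "spike_likelihood p a \<theta> v \<in> borel_measurable (euclidean_borel p)"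
proof -
  have "(\<lambda>y. \<lambda>i\<in>{..<p}. y i / sqrt a) \<in> measurable (euclidean_borel p) (PiM {..<p} (\<lambda>_. borel))"
    unfolding euclidean_borel_def by (intro measurable_restrict borel_measurable_divide) auto
  from measurable_compose[OF this spike_density_measurable[of "\<lambda>_. borel"]]
  show ?thesis unfolding spike_likelihood_def by simp
qed

lemma spike_likelihood_scaled:
  assumes "a > 0"
  shows "spike_likelihood p a \<theta> v (\<lambda>i\<in>{..<p}. sqrt a * z i) = ennreal (spike_density {..<p} \<theta> v z)"
proof -
  have "dot {..<p} v (\<lambda>i\<in>{..<p}. (\<lambda>i\<in>{..<p}. sqrt a * z i) i / sqrt a) = dot {..<p} v z"
    unfolding dot_def using assms by (intro sum.cong) auto
  then show ?thesis by (simp only: spike_likelihood_def spike_density_def)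
qed

lemma centered_gaussian_spiked:
  assumes v: "dot {..<p} v v = 1" and "a \<ge> 0" "\<theta> \<ge> -1"
  shows "centered_gaussian p (spiked p a \<theta> v) =
    distr (std_gaussian {..<p}) (euclidean_borel p)
      (\<lambda>z. \<lambda>i\<in>{..<p}. sqrt a * stretch {..<p} (sqrt (1 + \<theta>) - 1) v z i)"
proof -
  have "dot {..<p} v (vec_index (Matrix.vec p z)) = dot {..<p} v z" for z
    unfolding dot_def by (intro sum.cong) auto
  then have "(\<lambda>i\<in>{..<p}. vec_index (psd_sqrt p (spiked p a \<theta> v) *\<^sub>v Matrix.vec p z) i) =
      (\<lambda>i\<in>{..<p}. sqrt a * stretch {..<p} (sqrt (1 + \<theta>) - 1) v z i)" for z
    unfolding psd_sqrt_spiked[OF assms]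
    by (auto simp: spiked_mult_vec stretch_def intro!: restrict_ext simp del: index_mult_mat_vec)
  then show ?thesis by (simp only: centered_gaussian_def std_gaussian_def)
qed

lemma centered_gaussian_identity:
  assumes v: "dot {..<p} v v = 1" and "a \<ge> 0"
  shows "centered_gaussian p (spiked p a 0 v) = white_noise p a"
  unfolding white_noise_def
  using centered_gaussian_spiked[OF v \<open>a \<ge> 0\<close>, of 0]
  by (simp add: stretch_def cong: restrict_cong)

lemma centered_gaussian_spiked_density:
  assumes v: "dot {..<p} v v = 1" and a: "a > 0" and \<theta>: "\<theta> > -1"
  shows "centered_gaussian p (spiked p a \<theta> v) =
    density (white_noise p a) (spike_likelihood p a \<theta> v)"
proof (rule measure_eqI)
  show "sets (centered_gaussian p (spiked p a \<theta> v)) =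
      sets (density (white_noise p a) (spike_likelihood p a \<theta> v))"
    by (simp add: centered_gaussian_def sets_white_noise)
next
  fix A assume "A \<in> sets (centered_gaussian p (spiked p a \<theta> v))"
  then have A: "A \<in> sets (euclidean_borel p)" by (simp add: centered_gaussian_def)
  let ?\<kappa> = "sqrt (1 + \<theta>) - 1"
  let ?sc = "\<lambda>z :: nat \<Rightarrow> real. \<lambda>i\<in>{..<p}. sqrt a * z i"
  have st: "stretch {..<p} ?\<kappa> v \<in> measurable (std_gaussian {..<p}) (PiM {..<p} (\<lambda>_. borel))"
    unfolding std_gaussian_def by (rule stretch_measurable) simp
  have sc: "?sc \<in> measurable (PiM {..<p} (\<lambda>_. borel)) (euclidean_borel p)"
    by (rule scaling_measurable)
  have ind: "(indicator A :: _ \<Rightarrow> ennreal) \<in> borel_measurable (euclidean_borel p)" using A by simp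
  have "emeasure (centered_gaussian p (spiked p a \<theta> v)) A =
      (\<integral>\<^sup>+y. indicator A y \<partial>centered_gaussian p (spiked p a \<theta> v))"
    using A by (simp add: centered_gaussian_def)
  also have "\<dots> = (\<integral>\<^sup>+z. indicator A (?sc (stretch {..<p} ?\<kappa> v z)) \<partial>std_gaussian {..<p})"
    unfolding centered_gaussian_spiked[OF v less_imp_le[OF a] less_imp_le[OF \<theta>]]
    using measurable_compose[OF st sc] ind by (intro nn_integral_distr) auto
  also have "\<dots> = (\<integral>\<^sup>+x. indicator A (?sc x) * ennreal (spike_density {..<p} \<theta> v x) \<partial>std_gaussian {..<p})"
    by (rule stretched_gaussian_density[OF _ v \<theta>]) (use measurable_compose[OF sc ind] in auto)
  also have "\<dots> = (\<integral>\<^sup>+x. spike_likelihood p a \<theta> v (?sc x) * indicator A (?sc x) \<partial>std_gaussian {..<p})"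
    by (intro nn_integral_cong, subst spike_likelihood_scaled[OF a]) (rule mult.commute)
  also have "\<dots> = (\<integral>\<^sup>+y. spike_likelihood p a \<theta> v y * indicator A y \<partial>white_noise p a)"
    using A by (subst nn_integral_white_noise) auto
  also have "\<dots> = emeasure (density (white_noise p a) (spike_likelihood p a \<theta> v)) A"
    using A by (subst emeasure_density)
      (auto simp: sets_white_noise measurable_cong_sets[OF sets_white_noise refl])
  finally show "emeasure (centered_gaussian p (spiked p a \<theta> v)) A =
      emeasure (density (white_noise p a) (spike_likelihood p a \<theta> v)) A" .
qed

lemma contaminated_density:
  assumes P: "sets P = sets (euclidean_borel p)" and "centered_gaussian p \<Sigma> = density P f"
    and "Q = density P g" and fg: "f \<in> borel_measurable P" "g \<in> borel_measurable P"
  shows "contaminated p \<epsilon> \<Sigma> Q = density P (\<lambda>x. ennreal (1 - \<epsilon>) * f x + ennreal \<epsilon> * g x)"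
proof -
  note fg [measurable]
  let ?h = "\<lambda>x. ennreal (1 - \<epsilon>) * f x + ennreal \<epsilon> * g x"
  have sp: "space (euclidean_borel p) = space (density P ?h)"
    using sets_eq_imp_space_eq[OF P] by simp
  have st: "sets (euclidean_borel p) = sets (density P ?h)" using P by simp
  have "contaminated p \<epsilon> \<Sigma> Q = measure_of (space (density P ?h)) (sets (density P ?h)) (emeasure (density P ?h))"
    unfolding contaminated_def sp st
  proof (rule measure_of_eq[OF sets.space_closed])
    fix A assume "A \<in> sigma_sets (space (density P ?h)) (sets (density P ?h))"
    then have [measurable]: "A \<in> sets P" using sets.sigma_sets_eq[of "density P ?h"] by simp
    have "emeasure (density P ?h) A =
        (\<integral>\<^sup>+x. ennreal (1 - \<epsilon>) * (f x * indicator A x) + ennreal \<epsilon> * (g x * indicator A x) \<partial>P)"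
      by (subst emeasure_density) (auto simp: algebra_simps intro!: nn_integral_cong)
    also have "\<dots> = ennreal (1 - \<epsilon>) * emeasure (density P f) A + ennreal \<epsilon> * emeasure (density P g) A"
      by (subst nn_integral_add) (auto simp: nn_integral_cmult emeasure_density)
    finally show "ennreal (1 - \<epsilon>) * emeasure (centered_gaussian p \<Sigma>) A + ennreal \<epsilon> * emeasure Q A =
        emeasure (density P ?h) A"
      using assms by simp
  qed
  then show ?thesis by (simp only: measure_of_of_measure)
qed

lemma density_prob_dists:
  assumes "sets P = sets (euclidean_borel p)" "g \<in> borel_measurable P" "(\<integral>\<^sup>+x. g x \<partial>P) = 1"
  shows "density P g \<in> prob_dists p"
  unfolding prob_dists_def using assms
  by (auto intro!: prob_spaceI simp: emeasure_density cong: nn_integral_cong)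

lemma nn_integral_spike_likelihood:
  assumes v: "dot {..<p} v v = 1" and a: "a > 0" and \<theta>: "\<theta> > -1"
  shows "(\<integral>\<^sup>+y. spike_likelihood p a \<theta> v y \<partial>white_noise p a) = 1"
  using nn_integral_spike_density[OF _ v \<theta>]
  by (subst nn_integral_white_noise) (auto simp: spike_likelihood_scaled[OF a])

lemma nn_integral_spike_likelihood_product:
  assumes v: "dot {..<p} v v = 1" and w: "dot {..<p} w w = 1" and a: "a > 0"
    and \<theta>: "\<theta> > 0" "\<theta>\<^sup>2 \<le> 1 / 2"
  shows "(\<integral>\<^sup>+y. spike_likelihood p a \<theta> v y * spike_likelihood p a \<theta> w y \<partial>white_noise p a)
    \<le> ennreal (exp (\<theta>\<^sup>2 * (dot {..<p} v w)\<^sup>2))"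
  using spike_density_product_bound[OF _ v w \<theta>]
  by (subst nn_integral_white_noise) (auto simp: spike_likelihood_scaled[OF a])

lemma contaminated_by_itself:
  assumes v: "dot {..<p} v v = 1" and a: "a \<ge> 0" and "0 \<le> \<epsilon>" "\<epsilon> \<le> 1"
  shows "contaminated p \<epsilon> (spiked p a 0 v) (white_noise p a) = white_noise p a"
proof -
  have "white_noise p a = density (white_noise p a) (\<lambda>_. 1)" by (simp add: density_1)
  then have "contaminated p \<epsilon> (spiked p a 0 v) (white_noise p a) =
      density (white_noise p a) (\<lambda>x. ennreal (1 - \<epsilon>) * 1 + ennreal \<epsilon> * 1)"
    by (intro contaminated_density[OF sets_white_noise])
       (simp_all add: centered_gaussian_identity[OF v a])
  moreover have "ennreal (1 - \<epsilon>) + ennreal \<epsilon> = 1"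
    using assms by (subst ennreal_plus[symmetric]) auto
  ultimately show ?thesis by (simp add: density_1)
qed

lemma white_noise_prob_dists: "white_noise p a \<in> prob_dists p"
  by (simp add: prob_dists_def prob_space_white_noise sets_white_noise)

text \<open>
With \<open>\<sigma> = 1 - \<epsilon> / 2\<close> the spike has \<open>1 + \<theta> = \<sigma>\<^sup>2\<close>, and its likelihood is at most \<open>1 / \<sigma>\<close> because
\<open>\<theta> \<le> 0\<close>. As \<open>(1 - \<epsilon>) / \<sigma> \<le> 1\<close>, the defect \<open>1 - (1 - \<epsilon>) f\<close> is nonnegative, and after division by \<open>\<epsilon>\<close>
it is the density of the required contamination. With \<open>1 - \<epsilon> / 2\<close> in place of \<open>1 - \<epsilon>\<close> the
shrunk law stays nondegenerate at \<open>\<epsilon> = 1\<close>.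
\<close>

lemma contamination_hides_shrinkage:
  assumes v: "dot {..<p} v v = 1" and a: "a > 0" and \<epsilon>: "0 < \<epsilon>" "\<epsilon> \<le> 1"
  obtains Q where "Q \<in> prob_dists p"
    "contaminated p \<epsilon> (spiked p a ((1 - \<epsilon> / 2)\<^sup>2 - 1) v) Q = white_noise p a"
proof -
  let ?P = "white_noise p a"
  define \<theta> where "\<theta> = (1 - \<epsilon> / 2)\<^sup>2 - 1"
  have s: "1 + \<theta> = (1 - \<epsilon> / 2)\<^sup>2" "sqrt (1 + \<theta>) = 1 - \<epsilon> / 2" using \<epsilon> by (auto simp: \<theta>_def)
  have "(1 - \<epsilon> / 2)\<^sup>2 > 0" "(1 - \<epsilon> / 2)\<^sup>2 \<le> 1" using \<epsilon> by (auto simp: power_le_one)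
  then have \<theta>: "\<theta> > -1" "\<theta> \<le> 0" by (auto simp: \<theta>_def)
  define f where "f = spike_likelihood p a \<theta> v"
  define g where "g = (\<lambda>x. (1 - ennreal (1 - \<epsilon>) * f x) / ennreal \<epsilon>)"
  have f [measurable]: "f \<in> borel_measurable ?P"
    unfolding f_def by (simp add: measurable_cong_sets[OF sets_white_noise refl])
  have g [measurable]: "g \<in> borel_measurable ?P" unfolding g_def by measurable
  have le: "ennreal (1 - \<epsilon>) * f x \<le> 1" for x
  proof -
    have "(1 - \<epsilon>) * spike_density {..<p} \<theta> v y \<le> 1" for y
    proof -
      have "\<theta> / (1 + \<theta>) * (dot {..<p} v y)\<^sup>2 / 2 \<le> 0"
        using \<theta> by (intro divide_nonpos_nonneg mult_nonpos_nonneg) auto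
      then have "spike_density {..<p} \<theta> v y \<le> 1 / (1 - \<epsilon> / 2)"
        unfolding spike_density_def s(2) using \<epsilon> by (intro divide_right_mono) auto
      then have "(1 - \<epsilon>) * spike_density {..<p} \<theta> v y \<le> (1 - \<epsilon>) * (1 / (1 - \<epsilon> / 2))"
        using \<epsilon> by (intro mult_left_mono) auto
      also have "\<dots> \<le> 1" using \<epsilon> by (simp add: field_simps)
      finally show ?thesis .
    qed
    then show ?thesis
      unfolding f_def spike_likelihood_def using \<epsilon> \<theta>
      by (subst ennreal_mult[symmetric]) (auto simp: spike_density_nonneg ennreal_le_1)
  qed
  have mix: "ennreal (1 - \<epsilon>) * f x + ennreal \<epsilon> * g x = 1" for x
  proof -
    have "ennreal \<epsilon> * g x = 1 - ennreal (1 - \<epsilon>) * f x"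
      unfolding g_def ennreal_times_divide
      by (subst mult.commute, rule ennreal_mult_divide_eq) (use \<epsilon> in auto)
    then show ?thesis using le[of x] by (simp add: add_diff_inverse_ennreal)
  qed
  have "ennreal (1 - \<epsilon>) * 1 + ennreal \<epsilon> * (\<integral>\<^sup>+x. g x \<partial>?P) =
      (\<integral>\<^sup>+x. ennreal (1 - \<epsilon>) * f x + ennreal \<epsilon> * g x \<partial>?P)"
    using nn_integral_spike_likelihood[OF v a \<theta>(1)]
    by (subst nn_integral_add) (auto simp: nn_integral_cmult f_def[symmetric])
  also have "\<dots> = 1"
    unfolding mix using prob_space.emeasure_space_1[OF prob_space_white_noise] by simp
  also have "\<dots> = ennreal (1 - \<epsilon>) * 1 + ennreal \<epsilon> * 1"
    using \<epsilon> by (simp flip: ennreal_plus)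
  finally have "ennreal \<epsilon> * (\<integral>\<^sup>+x. g x \<partial>?P) = ennreal \<epsilon> * 1"
    by (simp only: ennreal_add_left_cancel) simp
  then have "(\<integral>\<^sup>+x. g x \<partial>?P) = 1"
    using \<epsilon> by (subst (asm) ennreal_mult_cancel_left) auto
  then have "density ?P g \<in> prob_dists p"
    by (intro density_prob_dists sets_white_noise g)
  moreover have "contaminated p \<epsilon> (spiked p a \<theta> v) (density ?P g) = ?P"
    using contaminated_density[OF sets_white_noise
      centered_gaussian_spiked_density[OF v a \<theta>(1)] refl] f g
    by (simp add: f_def[symmetric] mix density_1)
  ultimately show ?thesis using that unfolding \<theta>_def by blast
qed

lemma contaminated_spiked_density:
  assumes v: "dot {..<p} v v = 1" and a: "a > 0" and \<theta>: "\<theta> > -1"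
  shows "contaminated p \<epsilon> (spiked p a \<theta> v) (white_noise p a) =
    density (white_noise p a) (\<lambda>x. ennreal (1 - \<epsilon>) * spike_likelihood p a \<theta> v x + ennreal \<epsilon>)"
proof -
  have "white_noise p a = density (white_noise p a) (\<lambda>_. 1)" by (simp add: density_1)
  from contaminated_density[OF sets_white_noise centered_gaussian_spiked_density[OF v a \<theta>] this]
  show ?thesis by (simp add: measurable_cong_sets[OF sets_white_noise refl])
qed

text \<open>
Mixing the likelihood ratios, which have mean one, with the constant one preserves the bound, which is at least one: the product of
the mixtures has mean \<open>(1 - \<epsilon>)\<^sup>2\<close> times the original one plus \<open>1 - (1 - \<epsilon>)\<^sup>2\<close>.
\<close>

lemma contaminated_likelihood_product:
  assumes v: "dot {..<p} v v = 1" and w: "dot {..<p} w w = 1" and a: "a > 0"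
    and \<theta>: "\<theta> > 0" "\<theta>\<^sup>2 \<le> 1 / 2" and \<epsilon>: "0 \<le> \<epsilon>" "\<epsilon> \<le> 1"
  shows "(\<integral>\<^sup>+y. (ennreal (1 - \<epsilon>) * spike_likelihood p a \<theta> v y + ennreal \<epsilon>) *
      (ennreal (1 - \<epsilon>) * spike_likelihood p a \<theta> w y + ennreal \<epsilon>) \<partial>white_noise p a)
    \<le> ennreal (exp (\<theta>\<^sup>2 * (dot {..<p} v w)\<^sup>2))"
proof -
  let ?P = "white_noise p a"
  have [measurable]: "spike_likelihood p a \<theta> u \<in> borel_measurable ?P" for u
    by (simp add: measurable_cong_sets[OF sets_white_noise refl])
  let ?E = "exp (\<theta>\<^sup>2 * (dot {..<p} v w)\<^sup>2)"
  let ?I = "\<integral>\<^sup>+y. spike_likelihood p a \<theta> v y * spike_likelihood p a \<theta> w y \<partial>?P"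
  have "(\<integral>\<^sup>+y. (ennreal (1 - \<epsilon>) * spike_likelihood p a \<theta> v y + ennreal \<epsilon>) *
      (ennreal (1 - \<epsilon>) * spike_likelihood p a \<theta> w y + ennreal \<epsilon>) \<partial>?P) =
    (\<integral>\<^sup>+y. ennreal ((1 - \<epsilon>)\<^sup>2) * (spike_likelihood p a \<theta> v y * spike_likelihood p a \<theta> w y) +
      (ennreal ((1 - \<epsilon>) * \<epsilon>) * spike_likelihood p a \<theta> v y +
      (ennreal ((1 - \<epsilon>) * \<epsilon>) * spike_likelihood p a \<theta> w y + ennreal (\<epsilon>\<^sup>2))) \<partial>?P)"
  proof (rule nn_integral_cong)
    fix y
    have m: "ennreal ((1 - \<epsilon>)\<^sup>2) = ennreal (1 - \<epsilon>) * ennreal (1 - \<epsilon>)"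
      "ennreal ((1 - \<epsilon>) * \<epsilon>) = ennreal (1 - \<epsilon>) * ennreal \<epsilon>" "ennreal (\<epsilon>\<^sup>2) = ennreal \<epsilon> * ennreal \<epsilon>"
      using \<epsilon> by (simp_all add: power2_eq_square ennreal_mult)
    show "(ennreal (1 - \<epsilon>) * spike_likelihood p a \<theta> v y + ennreal \<epsilon>) *
        (ennreal (1 - \<epsilon>) * spike_likelihood p a \<theta> w y + ennreal \<epsilon>) =
      ennreal ((1 - \<epsilon>)\<^sup>2) * (spike_likelihood p a \<theta> v y * spike_likelihood p a \<theta> w y) +
      (ennreal ((1 - \<epsilon>) * \<epsilon>) * spike_likelihood p a \<theta> v y +
      (ennreal ((1 - \<epsilon>) * \<epsilon>) * spike_likelihood p a \<theta> w y + ennreal (\<epsilon>\<^sup>2)))"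
      unfolding m by (simp only: distrib_left distrib_right mult_ac add_ac)
  qed
  also have "\<dots> = ennreal ((1 - \<epsilon>)\<^sup>2) * ?I + (ennreal ((1 - \<epsilon>) * \<epsilon>) * 1 + (ennreal ((1 - \<epsilon>) * \<epsilon>) * 1 + ennreal (\<epsilon>\<^sup>2)))"
    using \<theta> nn_integral_spike_likelihood[OF v a, of \<theta>] nn_integral_spike_likelihood[OF w a, of \<theta>]
      prob_space.emeasure_space_1[OF prob_space_white_noise[of p a]]
    by (subst nn_integral_add; simp; (subst nn_integral_add; simp; (subst nn_integral_add; simp)?)?)
       (simp add: nn_integral_cmult)
  also have "\<dots> \<le> ennreal ((1 - \<epsilon>)\<^sup>2) * ennreal ?E + (ennreal ((1 - \<epsilon>) * \<epsilon>) * 1 + (ennreal ((1 - \<epsilon>) * \<epsilon>) * 1 + ennreal (\<epsilon>\<^sup>2)))"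
    by (intro add_mono mult_left_mono nn_integral_spike_likelihood_product[OF v w a \<theta>]) auto
  also have "\<dots> = ennreal ((1 - \<epsilon>)\<^sup>2 * ?E + (2 * (1 - \<epsilon>) * \<epsilon> + \<epsilon>\<^sup>2))"
    using \<epsilon> by (simp add: ennreal_mult[symmetric] ennreal_plus[symmetric] del: ennreal_plus)
  also have "\<dots> \<le> ennreal ?E"
  proof (rule ennreal_leI)
    have "2 * (1 - \<epsilon>) * \<epsilon> + \<epsilon>\<^sup>2 = 1 - (1 - \<epsilon>)\<^sup>2" by (simp add: power2_eq_square algebra_simps)
    moreover have "(1 - (1 - \<epsilon>)\<^sup>2) * 1 \<le> (1 - (1 - \<epsilon>)\<^sup>2) * ?E"
      using \<epsilon> by (intro mult_left_mono) (auto simp: power_le_one)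
    ultimately show "(1 - \<epsilon>)\<^sup>2 * ?E + (2 * (1 - \<epsilon>) * \<epsilon> + \<epsilon>\<^sup>2) \<le> ?E"
      by (simp add: algebra_simps)
  qed
  finally show ?thesis .
qed

section \<open>The random sparse direction and its overlaps\<close>

lemma nn_integral_exp_normal:
  "(\<integral>\<^sup>+x. ennreal (std_normal_density x * exp (t * x)) \<partial>lborel) = ennreal (exp (t\<^sup>2 / 2))"
proof -
  have "- x\<^sup>2 / 2 + t * x = t\<^sup>2 / 2 + - (x - t)\<^sup>2 / 2" for x
    by (simp add: power2_eq_square field_simps)
  then have "exp (- x\<^sup>2 / 2) * exp (t * x) = exp (t\<^sup>2 / 2) * exp (- (x - t)\<^sup>2 / 2)" for x
    unfolding exp_add[symmetric] by presburger
  then have eq: "std_normal_density x * exp (t * x) = exp (t\<^sup>2 / 2) * normal_density t 1 x" for x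
    unfolding normal_density_def by simp
  show ?thesis
    unfolding eq using prob_space.emeasure_space_1[OF prob_space_normal_density[of 1 t]]
    by (simp add: ennreal_mult nn_integral_cmult emeasure_density)
qed

lemma nn_integral_exp_square_normal:
  assumes "b < 1"
  shows "(\<integral>\<^sup>+x. ennreal (std_normal_density x * exp (b * x\<^sup>2 / 2)) \<partial>lborel) = ennreal (1 / sqrt (1 - b))"
proof -
  define c where "c = 1 / sqrt (1 - b)"
  have c: "c > 0" "c\<^sup>2 = 1 / (1 - b)" using assms by (auto simp: c_def power_divide)
  have eq: "std_normal_density x * exp (b * x\<^sup>2 / 2) = c * normal_density 0 c x" for x
  proof -
    have "- x\<^sup>2 / 2 + b * x\<^sup>2 / 2 = - (x - 0)\<^sup>2 / (2 * c\<^sup>2)"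
      using assms unfolding c by (simp add: field_simps)
    then have "exp (- x\<^sup>2 / 2) * exp (b * x\<^sup>2 / 2) = exp (- (x - 0)\<^sup>2 / (2 * c\<^sup>2))"
      unfolding exp_add[symmetric] by presburger
    moreover have "c * (1 / sqrt (2 * pi * c\<^sup>2)) = 1 / sqrt (2 * pi)"
      using c(1) by (simp add: real_sqrt_mult)
    moreover have "c * normal_density 0 c x =
        (c * (1 / sqrt (2 * pi * c\<^sup>2))) * exp (- (x - 0)\<^sup>2 / (2 * c\<^sup>2))"
      by (simp add: normal_density_def)
    moreover have "std_normal_density x * exp (b * x\<^sup>2 / 2) =
        1 / sqrt (2 * pi) * (exp (- x\<^sup>2 / 2) * exp (b * x\<^sup>2 / 2))"
      by (simp add: std_normal_density_def)
    ultimately show ?thesis by metis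
  qed
  show ?thesis
    unfolding eq c_def[symmetric]
    using prob_space.emeasure_space_1[OF prob_space_normal_density[OF c(1), of 0]] c(1)
    by (simp add: ennreal_mult nn_integral_cmult emeasure_density)
qed

text \<open>
The left side is the moment generating function of a variable that is \<open>0\<close> with probability
\<open>1 - 1 / m\<close> and otherwise a uniform sign. Write \<open>L = ln (2 e m)\<close>. For \<open>|t| \<le> L / 2\<close> the bound
\<open>cosh t - 1 \<le> t\<^sup>2 exp |t| / 2\<close> suffices, since \<open>exp |t| \<le> sqrt (2 e m)\<close> leaves a factor of order
\<open>1 / sqrt m\<close>, which is at most a multiple of \<open>1 / L\<close>. For larger \<open>|t|\<close> the trivial bound \<open>exp |t|\<close> suffices because
\<open>|t| \<le> 2 t\<^sup>2 / L\<close>. The variance \<open>1 / m\<close> itself would not do as a variance proxy for large \<open>t\<close>.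
\<close>

lemma rare_sign_mgf:
  fixes m t :: real
  assumes m: "m \<ge> 1"
  shows "1 + (cosh t - 1) / m \<le> exp (6 * t\<^sup>2 / ln (2 * exp 1 * m))"
proof -
  define L where "L = ln (2 * exp 1 * m)"
  have "L = 1 + ln (2 * m)" unfolding L_def using m by (simp add: ln_mult)
  then have L: "L > 0" using m by (simp add: add_pos_nonneg)
  define u where "u = \<bar>t\<bar>"
  have u: "u \<ge> 0" "u\<^sup>2 = t\<^sup>2" by (auto simp: u_def)
  define E where "E = exp u"
  have E: "E \<ge> 1" using u by (simp add: E_def)
  have ch: "cosh t = (E + 1 / E) / 2"
    unfolding cosh_def u_def E_def by (auto simp: abs_if exp_minus inverse_eq_divide)
  show ?thesis
  proof (cases "u \<le> L / 2")
    case True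
    define r where "r = sqrt (2 * exp 1 * m)"
    have r: "r > 0" "r * r = 2 * exp 1 * m" using m by (auto simp: r_def)
    have Lr: "L = 2 * ln r" unfolding L_def r_def using m by (simp add: ln_sqrt)
    have "E \<le> exp (L / 2)" using True by (simp add: E_def)
    also have "\<dots> = r" unfolding Lr using r by simp
    finally have "E \<le> r" .
    \<comment> \<open>\<open>cosh t - 1 = (E - 1)\<^sup>2 / (2 E)\<close> and \<open>E - 1 \<le> u E\<close>\<close>
    have "1 - u \<le> exp (- u)" using exp_ge_add_one_self[of "- u"] by simp
    then have "(1 - u) * E \<le> exp (- u) * E" using E by (intro mult_right_mono) auto
    then have "E - 1 \<le> u * E" by (simp add: E_def exp_minus algebra_simps)
    then have "(E - 1)\<^sup>2 \<le> (u * E)\<^sup>2" using E by (intro power_mono) auto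
    then have "(E - 1)\<^sup>2 / (2 * E) \<le> (u * E)\<^sup>2 / (2 * E)" using E by (intro divide_right_mono) auto
    moreover have "E \<noteq> 0" using E by simp
    then have "cosh t - 1 = (E - 1)\<^sup>2 / (2 * E)" "(u * E)\<^sup>2 / (2 * E) = u\<^sup>2 * E / 2"
      unfolding ch by (simp_all add: power2_eq_square field_simps)
    ultimately have "cosh t - 1 \<le> u\<^sup>2 * E / 2" by simp
    also have "\<dots> \<le> u\<^sup>2 * r / 2" using \<open>E \<le> r\<close> by (intro divide_right_mono mult_left_mono) auto
    finally have "(cosh t - 1) / m \<le> u\<^sup>2 * r / 2 / m" using m by (intro divide_right_mono) auto
    also have "\<dots> \<le> 6 * u\<^sup>2 / L"
    proof -
      have "L \<le> 2 * r" unfolding Lr using ln_le_minus_one[OF r(1)] by simp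
      then have "L * r \<le> 2 * r * r" using r by (intro mult_right_mono) auto
      also have "\<dots> = 4 * (exp 1 * m)" using r by simp
      also have "\<dots> \<le> 4 * (3 * m)" using exp_le m by (intro mult_left_mono mult_right_mono) auto
      finally have "L * r * u\<^sup>2 \<le> 12 * m * u\<^sup>2" by (intro mult_right_mono) auto
      moreover have "L > 0" "m > 0" using L m by auto
      ultimately show ?thesis by (simp add: divide_simps mult_ac)
    qed
    finally have "1 + (cosh t - 1) / m \<le> 1 + 6 * u\<^sup>2 / L" by simp
    also have "\<dots> \<le> exp (6 * u\<^sup>2 / L)" by (rule exp_ge_add_one_self)
    finally show ?thesis by (simp add: L_def u)
  next
    case False
    have "1 / E \<le> 1" using E by simp
    then have "(E + 1 / E) / 2 \<le> (E + E) / 2"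
      using E by (intro divide_right_mono add_left_mono) (rule order_trans, auto)
    then have "cosh t \<le> E" unfolding ch by simp
    have "(cosh t - 1) / m \<le> (cosh t - 1) / 1"
      using m cosh_real_ge_1[of t] by (intro divide_left_mono) auto
    then have "1 + (cosh t - 1) / m \<le> exp u" using \<open>cosh t \<le> E\<close> by (simp add: E_def)
    also have "\<dots> \<le> exp (6 * u\<^sup>2 / L)"
    proof -
      have "u * L \<le> u * (6 * u)" using False u(1) by (intro mult_left_mono) auto
      then have "u * L \<le> 6 * u\<^sup>2" by (simp add: power2_eq_square)
      then show ?thesis using L by (simp add: pos_le_divide_eq)
    qed
    finally show ?thesis by (simp add: L_def u)
  qed
qed

text \<open>
A choice of one coordinate and one sign in each of \<open>s\<close> blocks of length \<open>m\<close>. Fixing one coordinate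
per block, in place of an arbitrary set of \<open>s\<close> coordinates, makes the blocks independent under the
uniform distribution.
\<close>

definition block_choices :: "nat \<Rightarrow> nat \<Rightarrow> (nat \<Rightarrow> nat \<times> bool) set" where
  "block_choices s m = PiE {..<s} (\<lambda>_. {..<m} \<times> UNIV)"

text \<open>
The contribution of one block to the overlap: the product of the signs if the same coordinate is
chosen, and zero otherwise.
\<close>

definition agreement :: "nat \<times> bool \<Rightarrow> nat \<times> bool \<Rightarrow> real" where
  "agreement x y = (if fst x = fst y then if snd x = snd y then 1 else -1 else 0)"

lemma finite_block_choices: "finite (block_choices s m)"
  unfolding block_choices_def by (intro finite_PiE) auto

lemma card_block_choices: "card (block_choices s m) = (2 * m) ^ s"
  unfolding block_choices_def by (simp add: card_PiE card_cartesian_product mult.commute)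

lemma sum_exp_agreement:
  assumes "j < m"
  shows "(\<Sum>y\<in>{..<m} \<times> UNIV. exp (t * agreement (j, b) y)) = 2 * (real m + (cosh t - 1))"
proof -
  have eq: "(\<Sum>c\<in>UNIV. exp (t * agreement (j, b) (k, c))) = 2 + (if k = j then 2 * (cosh t - 1) else 0)" for k
    by (cases b) (auto simp: UNIV_bool agreement_def cosh_def)
  have "(\<Sum>y\<in>{..<m} \<times> UNIV. exp (t * agreement (j, b) y)) =
      (\<Sum>k<m. \<Sum>c\<in>UNIV. exp (t * agreement (j, b) (k, c)))"
    by (subst sum.cartesian_product) (simp add: case_prod_beta)
  also have "\<dots> = 2 * (real m + (cosh t - 1))"
    unfolding eq using assms by (simp add: sum.distrib)
  finally show ?thesis .
qed

text \<open>
By independence of the blocks the sum factorises, and by symmetry each factor is the same for every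
value of \<open>\<tau>\<close> in that block.
\<close>

lemma sum_exp_overlap:
  assumes "\<tau> \<in> block_choices s m" "m \<ge> 1"
  shows "(\<Sum>\<tau>'\<in>block_choices s m. exp (t * (\<Sum>b<s. agreement (\<tau> b) (\<tau>' b)))) =
    real (card (block_choices s m)) * (1 + (cosh t - 1) / real m) ^ s"
proof -
  have "(\<Sum>\<tau>'\<in>block_choices s m. exp (t * (\<Sum>b<s. agreement (\<tau> b) (\<tau>' b)))) =
      (\<Sum>\<tau>'\<in>block_choices s m. \<Prod>b<s. exp (t * agreement (\<tau> b) (\<tau>' b)))"
    by (simp add: sum_distrib_left exp_sum)
  also have "\<dots> = (\<Prod>b<s. \<Sum>y\<in>{..<m} \<times> UNIV. exp (t * agreement (\<tau> b) y))"
    unfolding block_choices_def by (rule prod_sum_PiE[symmetric]) auto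
  also have "\<dots> = (\<Prod>b<s. 2 * (real m + (cosh t - 1)))"
  proof (rule prod.cong[OF refl])
    fix b assume "b \<in> {..<s}"
    then have "\<tau> b \<in> {..<m} \<times> UNIV" using assms by (auto simp: block_choices_def)
    then show "(\<Sum>y\<in>{..<m} \<times> UNIV. exp (t * agreement (\<tau> b) y)) = 2 * (real m + (cosh t - 1))"
      using sum_exp_agreement[of "fst (\<tau> b)" m t "snd (\<tau> b)"] by auto
  qed
  also have "2 * (real m + (cosh t - 1)) = (2 * real m) * (1 + (cosh t - 1) / real m)"
    using assms(2) by (simp add: distrib_left)
  also have "(\<Prod>b<s. (2 * real m) * (1 + (cosh t - 1) / real m)) =
      (2 * real m) ^ s * (1 + (cosh t - 1) / real m) ^ s"
    by (simp add: power_mult_distrib)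
  finally show ?thesis by (simp add: card_block_choices)
qed

text \<open>
The exponential of a square is a Gaussian average of exponentials: \<open>exp (\<gamma> G\<^sup>2)\<close> is the mean of
\<open>exp (sqrt (2 \<gamma>) x G)\<close> over a standard normal \<open>x\<close>. After exchanging this average with the sum over \<open>\<tau>'\<close>,
the sub-Gaussian bound with constant \<open>6\<close> leaves the exponent \<open>12 \<gamma> s x\<^sup>2 / L\<close>, where \<open>L = ln (2 e m)\<close>. The constant \<open>48\<close>
makes it at most \<open>x\<^sup>2 / 4\<close>, whose Gaussian mean is \<open>sqrt 2\<close>.
\<close>

lemma overlap_exp_square_moment:
  assumes \<tau>: "\<tau> \<in> block_choices s m" and m: "m \<ge> 1"
    and \<gamma>: "0 \<le> \<gamma>" "\<gamma> * real s \<le> ln (2 * exp 1 * real m) / 48"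
  shows "(\<Sum>\<tau>'\<in>block_choices s m. exp (\<gamma> * (\<Sum>b<s. agreement (\<tau> b) (\<tau>' b))\<^sup>2))
    \<le> 2 * real (card (block_choices s m))"
proof -
  let ?V = "block_choices s m"
  let ?G = "\<lambda>\<tau>'. \<Sum>b<s. agreement (\<tau> b) (\<tau>' b)"
  define L where "L = ln (2 * exp 1 * real m)"
  have "L = 1 + ln (2 * real m)" unfolding L_def using m by (simp add: ln_mult)
  then have L: "L > 0" using m by (simp add: add_pos_nonneg)
  define c where "c = sqrt (2 * \<gamma>)"
  have c2: "c\<^sup>2 = 2 * \<gamma>" using \<gamma> by (simp add: c_def)
  have HS: "ennreal (exp (\<gamma> * G\<^sup>2)) = (\<integral>\<^sup>+x. ennreal (std_normal_density x * exp (c * G * x)) \<partial>lborel)" for G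
    unfolding nn_integral_exp_normal by (simp add: power_mult_distrib c2)
  have "ennreal (\<Sum>\<tau>'\<in>?V. exp (\<gamma> * (?G \<tau>')\<^sup>2)) = (\<Sum>\<tau>'\<in>?V. ennreal (exp (\<gamma> * (?G \<tau>')\<^sup>2)))"
    by simp
  also have "\<dots> = (\<integral>\<^sup>+x. (\<Sum>\<tau>'\<in>?V. ennreal (std_normal_density x * exp (c * ?G \<tau>' * x))) \<partial>lborel)"
    unfolding HS by (rule nn_integral_sum[symmetric]) measurable
  also have "\<dots> \<le> (\<integral>\<^sup>+x. ennreal (real (card ?V)) *
      ennreal (std_normal_density x * exp (1 / 2 * x\<^sup>2 / 2)) \<partial>lborel)"
  proof (rule nn_integral_mono)
    fix x :: real
    have "(\<Sum>\<tau>'\<in>?V. exp (c * ?G \<tau>' * x)) = real (card ?V) * (1 + (cosh (c * x) - 1) / real m) ^ s"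
      using sum_exp_overlap[OF \<tau> m, of "c * x"] by (simp add: mult_ac)
    also have "\<dots> \<le> real (card ?V) * exp (6 * (c * x)\<^sup>2 / L) ^ s"
      unfolding L_def using m rare_sign_mgf[of "real m" "c * x"] cosh_real_ge_1[of "c * x"]
      by (intro mult_left_mono power_mono) auto
    also have "\<dots> = real (card ?V) * exp (real s * (6 * (c * x)\<^sup>2 / L))"
      by (simp only: exp_of_nat_mult)
    also have "\<dots> \<le> real (card ?V) * exp (1 / 2 * x\<^sup>2 / 2)"
    proof (intro mult_left_mono)
      have "real s * (6 * (c * x)\<^sup>2 / L) = (\<gamma> * real s) * (12 * x\<^sup>2 / L)"
        by (simp add: power_mult_distrib c2)
      also have "\<dots> \<le> L / 48 * (12 * x\<^sup>2 / L)"
        using \<gamma>(2) L unfolding L_def[symmetric] by (intro mult_right_mono) auto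
      also have "\<dots> = 1 / 2 * x\<^sup>2 / 2" using L by simp
      finally show "exp (real s * (6 * (c * x)\<^sup>2 / L)) \<le> exp (1 / 2 * x\<^sup>2 / 2)" by simp
    qed auto
    finally have "std_normal_density x * (\<Sum>\<tau>'\<in>?V. exp (c * ?G \<tau>' * x)) \<le>
        std_normal_density x * (real (card ?V) * exp (1 / 2 * x\<^sup>2 / 2))"
      by (intro mult_left_mono) auto
    moreover have "(\<Sum>\<tau>'\<in>?V. ennreal (std_normal_density x * exp (c * ?G \<tau>' * x))) =
        ennreal (std_normal_density x * (\<Sum>\<tau>'\<in>?V. exp (c * ?G \<tau>' * x)))"
      by (simp add: sum_distrib_left)
    moreover have "ennreal (real (card ?V)) * ennreal (std_normal_density x * exp (1 / 2 * x\<^sup>2 / 2)) =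
        ennreal (std_normal_density x * (real (card ?V) * exp (1 / 2 * x\<^sup>2 / 2)))"
      by (subst ennreal_mult[symmetric]) (auto simp: mult_ac)
    ultimately show "(\<Sum>\<tau>'\<in>?V. ennreal (std_normal_density x * exp (c * ?G \<tau>' * x))) \<le>
        ennreal (real (card ?V)) * ennreal (std_normal_density x * exp (1 / 2 * x\<^sup>2 / 2))"
      by (simp only:) (rule ennreal_leI)
  qed
  also have "\<dots> = ennreal (real (card ?V)) * ennreal (1 / sqrt (1 - 1 / 2))"
    by (subst nn_integral_cmult) (simp_all only: nn_integral_exp_square_normal, measurable)
  also have "\<dots> = ennreal (real (card ?V) * sqrt 2)"
    by (subst ennreal_mult[symmetric]) (auto simp: real_sqrt_divide)
  also have "\<dots> \<le> ennreal (2 * real (card ?V))"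
    using real_sqrt_le_mono[of 2 4] mult_right_mono[of "sqrt 2" 2 "real (card ?V)"]
    by (intro ennreal_leI) (simp add: mult.commute)
  finally show ?thesis by (subst (asm) ennreal_le_iff) auto
qed

section \<open>Testing one law against a mixture\<close>

text \<open>
If \<open>A\<close> had small probability under \<open>P\<close> and its complement under each alternative, then \<open>A\<close> would carry
more than \<open>3/4\<close> of the uniform mixture of the alternatives. That is impossible when the likelihood ratio \<open>L\<close> of the
mixture has second moment at most \<open>2\<close>: integrating \<open>L \<le> L\<^sup>2 / 4 + 1\<close> over \<open>A\<close> gives at most
\<open>1/2 + P(A)\<close>. The hypothesis bounds the second moment for each \<open>\<tau>\<close> separately, averaged over \<open>\<tau>'\<close> only.
\<close>

lemma second_moment_bound:
  assumes P: "prob_space P" and V: "finite V" "V \<noteq> {}"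
    and f: "\<And>\<tau>. \<tau> \<in> V \<Longrightarrow> f \<tau> \<in> borel_measurable P"
    and f1: "\<And>\<tau>. \<tau> \<in> V \<Longrightarrow> (\<integral>\<^sup>+x. f \<tau> x \<partial>P) = 1"
    and second: "\<And>\<tau>. \<tau> \<in> V \<Longrightarrow> (\<Sum>\<tau>'\<in>V. \<integral>\<^sup>+x. f \<tau> x * f \<tau>' x \<partial>P) \<le> ennreal (2 * real (card V))"
    and A: "A \<in> sets P"
  shows "emeasure P A \<ge> ennreal (1 / 4) \<or>
    (\<exists>\<tau>\<in>V. emeasure (density P (f \<tau>)) (space P - A) \<ge> ennreal (1 / 4))"
proof (rule ccontr)
  assume neg: "\<not> ?thesis"
  interpret prob_space P by (rule P)
  note f [measurable]
  define N where "N = real (card V)"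
  have N: "N > 0" using V by (simp add: N_def card_gt_0_iff)
  define S where "S = (\<lambda>x. \<Sum>\<tau>\<in>V. f \<tau> x)"
  have S [measurable]: "S \<in> borel_measurable P" unfolding S_def using f by (intro borel_measurable_sum) auto
  have S1: "(\<integral>\<^sup>+x. S x \<partial>P) = ennreal N"
    unfolding S_def using f f1 by (subst nn_integral_sum) (auto simp: N_def ennreal_of_nat_eq_real_of_nat)
  have SS: "(\<integral>\<^sup>+x. S x * S x \<partial>P) \<le> ennreal (2 * N * N)"
  proof -
    have "(\<integral>\<^sup>+x. S x * S x \<partial>P) = (\<Sum>\<tau>\<in>V. \<Sum>\<tau>'\<in>V. \<integral>\<^sup>+x. f \<tau> x * f \<tau>' x \<partial>P)"
      unfolding S_def sum_product using f
      by (subst nn_integral_sum) (auto intro!: sum.cong nn_integral_sum borel_measurable_sum)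
    also have "\<dots> \<le> (\<Sum>\<tau>\<in>V. ennreal (2 * N))"
      unfolding N_def by (rule sum_mono) (rule second)
    also have "\<dots> = ennreal (2 * N * N)"
      using N by (simp add: N_def ennreal_of_nat_eq_real_of_nat ennreal_mult[symmetric] mult_ac)
    finally show ?thesis .
  qed
  \<comment> \<open>This is \<open>L \<le> L\<^sup>2 / 4 + 1\<close> for the averaged likelihood ratio \<open>L = S / N\<close>. The weight
     \<open>1/4\<close> turns the second moment bound \<open>2\<close> into mixture mass at most \<open>1/2\<close> plus that of \<open>P\<close>.\<close>
  have am_gm: "y \<le> ennreal (1 / (4 * N)) * (y * y) + ennreal N" for y :: ennreal
  proof (cases y)
    case (real r)
    have "0 \<le> (r - 2 * N)\<^sup>2 / (4 * N)" using N by simp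
    also have "\<dots> = 1 / (4 * N) * (r * r) + N - r"
      using N by (simp add: power2_eq_square field_simps)
    finally have "r \<le> 1 / (4 * N) * (r * r) + N" by simp
    then have "ennreal r \<le> ennreal (1 / (4 * N) * (r * r) + N)" by (rule ennreal_leI)
    also have "\<dots> = ennreal (1 / (4 * N)) * (ennreal r * ennreal r) + ennreal N"
      using N \<open>0 \<le> r\<close> ennreal_mult[of "1 / (4 * N)" "r * r"] ennreal_mult[of r r]
      by (subst ennreal_plus) auto
    finally show ?thesis using real by simp
  next
    case top
    then show ?thesis using N by (simp add: ennreal_mult_top)
  qed
  let ?B = "space P - A"
  have B: "?B \<in> sets P" using A by auto
  have PA: "emeasure P A < ennreal (1 / 4)" using neg by (auto simp: not_le)
  have "ennreal N = (\<integral>\<^sup>+x. S x * indicator A x + S x * indicator ?B x \<partial>P)"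
    unfolding S1[symmetric] by (intro nn_integral_cong) (auto simp: indicator_def)
  also have "\<dots> = (\<integral>\<^sup>+x. S x * indicator A x \<partial>P) + (\<integral>\<^sup>+x. S x * indicator ?B x \<partial>P)"
    using A B by (intro nn_integral_add) auto
  also have "(\<integral>\<^sup>+x. S x * indicator ?B x \<partial>P) = (\<Sum>\<tau>\<in>V. emeasure (density P (f \<tau>)) ?B)"
    unfolding S_def sum_distrib_right using f B
    by (subst nn_integral_sum) (auto simp: emeasure_density)
  also have "\<dots> \<le> (\<Sum>\<tau>\<in>V. ennreal (1 / 4))"
    using neg by (intro sum_mono) (auto simp: not_le)
  also have "\<dots> = ennreal (N / 4)"
    by (simp add: N_def ennreal_of_nat_eq_real_of_nat ennreal_mult[symmetric])
  also have "(\<integral>\<^sup>+x. S x * indicator A x \<partial>P) \<le>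
      (\<integral>\<^sup>+x. ennreal (1 / (4 * N)) * (S x * S x) + ennreal N * indicator A x \<partial>P)"
    using am_gm by (intro nn_integral_mono) (auto simp: indicator_def)
  also have "\<dots> = ennreal (1 / (4 * N)) * (\<integral>\<^sup>+x. S x * S x \<partial>P) + ennreal N * emeasure P A"
    using A by (subst nn_integral_add) (auto simp: nn_integral_cmult)
  also have "\<dots> \<le> ennreal (1 / (4 * N)) * ennreal (2 * N * N) + ennreal N * emeasure P A"
    by (intro add_mono mult_left_mono SS) auto
  also have "ennreal (1 / (4 * N)) * ennreal (2 * N * N) = ennreal (N / 2)"
    using N by (subst ennreal_mult[symmetric]) auto
  finally have le: "ennreal N \<le> ennreal (N / 2) + ennreal N * emeasure P A + ennreal (N / 4)"
    by (simp add: add_mono)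
  obtain q where q: "emeasure P A = ennreal q" "q \<ge> 0" "q < 1 / 4"
    using PA by (cases "emeasure P A") (auto simp: ennreal_less_iff)
  have "ennreal (N / 2 + N * q + N / 4) = ennreal (N / 2 + N * q) + ennreal (N / 4)"
    "ennreal (N / 2 + N * q) = ennreal (N / 2) + ennreal (N * q)" "ennreal (N * q) = ennreal N * ennreal q"
    using N q by (intro ennreal_plus ennreal_mult; simp)+
  then have "ennreal N \<le> ennreal (N / 2 + N * q + N / 4)"
    using le q(1) by metis
  then have "N \<le> N / 2 + N * q + N / 4" using N q by (subst (asm) ennreal_le_iff) auto
  moreover have "N * q < N * (1 / 4)" using N q by (intro mult_strict_left_mono) auto
  ultimately show False by simp
qed

lemma PiM_density_iid:
  assumes I: "finite I" and P: "prob_space P" and f: "f \<in> borel_measurable P" "(\<integral>\<^sup>+x. f x \<partial>P) = 1"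
  shows "PiM I (\<lambda>_. density P f) = density (PiM I (\<lambda>_. P)) (\<lambda>X. \<Prod>k\<in>I. f (X k))"
proof -
  have "prob_space (density P f)"
    using f by (intro prob_spaceI) (auto simp: emeasure_density cong: nn_integral_cong)
  then show ?thesis
    using P f by (intro PiM_density I) (auto intro: prob_space_imp_sigma_finite)
qed

section \<open>Likelihood ratios for random sparse spikes\<close>

text \<open>
The unit vector belonging to a choice of coordinates and signs; coordinates from \<open>s * m\<close> on are
left over by the division into blocks and stay zero.
\<close>

definition block_spike :: "nat \<Rightarrow> nat \<Rightarrow> (nat \<Rightarrow> nat \<times> bool) \<Rightarrow> nat \<Rightarrow> real" where
  "block_spike s m \<tau> i =
    (if i < s * m \<and> fst (\<tau> (i div m)) = i mod m
     then (if snd (\<tau> (i div m)) then 1 else -1) / sqrt (real s) else 0)"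

lemma block_index_less:
  fixes b j s m :: nat
  assumes "b < s" "j < m"
  shows "b * m + j < s * m"
proof -
  have "b * m + j < Suc b * m" using assms by simp
  also have "\<dots> \<le> s * m" using assms by (intro mult_right_mono) auto
  finally show ?thesis .
qed

lemma sum_blocks:
  fixes g :: "nat \<Rightarrow> real"
  assumes "m \<ge> 1"
  shows "(\<Sum>i<s * m. g i) = (\<Sum>b<s. \<Sum>j<m. g (b * m + j))"
proof -
  have "bij_betw (\<lambda>(b, j). b * m + j) ({..<s} \<times> {..<m}) {..<s * m}"
  proof (rule bij_betwI[where g = "\<lambda>i. (i div m, i mod m)"])
    show "(\<lambda>(b, j). b * m + j) \<in> {..<s} \<times> {..<m} \<rightarrow> {..<s * m}"
      by (auto simp: block_index_less)
    show "(\<lambda>i. (i div m, i mod m)) \<in> {..<s * m} \<rightarrow> {..<s} \<times> {..<m}"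
      using assms by (auto simp: less_mult_imp_div_less)
  qed (use assms in auto)
  from sum.reindex_bij_betw[OF this, of g]
  show ?thesis by (simp add: sum.cartesian_product case_prod_beta)
qed

lemma dot_block_spike:
  assumes "\<tau> \<in> block_choices s m" "\<tau>' \<in> block_choices s m" and m: "m \<ge> 1" and s: "s \<ge> 1" and p: "s * m \<le> p"
  shows "dot {..<p} (block_spike s m \<tau>) (block_spike s m \<tau>') =
    (\<Sum>b<s. agreement (\<tau> b) (\<tau>' b)) / real s"
proof -
  let ?v = "block_spike s m \<tau>" and ?w = "block_spike s m \<tau>'"
  have "dot {..<p} ?v ?w = (\<Sum>i<s * m. ?v i * ?w i)"
    unfolding dot_def using p by (intro sum.mono_neutral_right) (auto simp: block_spike_def)
  also have "\<dots> = (\<Sum>b<s. \<Sum>j<m. ?v (b * m + j) * ?w (b * m + j))"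
    by (rule sum_blocks[OF m])
  also have "\<dots> = (\<Sum>b<s. agreement (\<tau> b) (\<tau>' b) / real s)"
  proof (rule sum.cong[OF refl])
    fix b assume b: "b \<in> {..<s}"
    have "\<tau> b \<in> {..<m} \<times> UNIV" using assms(1) b unfolding block_choices_def by (rule PiE_mem)
    then have j: "fst (\<tau> b) < m" by auto
    have lt: "b * m + j < s * m" if "j < m" for j
      using that b by (simp add: block_index_less)
    have "(\<Sum>j<m. ?v (b * m + j) * ?w (b * m + j)) =
        (\<Sum>j<m. if j = fst (\<tau> b) then agreement (\<tau> b) (\<tau>' b) / real s else 0)"
      by (intro sum.cong) (auto simp: block_spike_def lt agreement_def)
    also have "\<dots> = agreement (\<tau> b) (\<tau>' b) / real s" using j by simp
    finally show "(\<Sum>j<m. ?v (b * m + j) * ?w (b * m + j)) = agreement (\<tau> b) (\<tau>' b) / real s" .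
  qed
  finally show ?thesis by (simp add: sum_divide_distrib)
qed

lemma block_spike_unit:
  assumes "\<tau> \<in> block_choices s m" and "m \<ge> 1" and s: "s \<ge> 1" and "s * m \<le> p"
  shows "dot {..<p} (block_spike s m \<tau>) (block_spike s m \<tau>) = 1"
  using dot_block_spike[OF assms(1) assms(1) assms(2,3,4)] s by (simp add: agreement_def)

lemma card_support_block_spike:
  assumes "m \<ge> 1"
  shows "card {i. i < p \<and> block_spike s m \<tau> i \<noteq> 0} \<le> s"
proof -
  have "{i. i < p \<and> block_spike s m \<tau> i \<noteq> 0} \<subseteq> (\<lambda>b. b * m + fst (\<tau> b)) ` {..<s}"
  proof clarify
    fix i assume "i < p" "block_spike s m \<tau> i \<noteq> 0"
    then have "i < s * m" "fst (\<tau> (i div m)) = i mod m" by (auto simp: block_spike_def split: if_splits)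
    then have "i = (i div m) * m + fst (\<tau> (i div m))" "i div m < s"
      by (auto simp: less_mult_imp_div_less)
    then show "i \<in> (\<lambda>b. b * m + fst (\<tau> b)) ` {..<s}" by blast
  qed
  then have "card {i. i < p \<and> block_spike s m \<tau> i \<noteq> 0} \<le> card ((\<lambda>b. b * m + fst (\<tau> b)) ` {..<s})"
    by (intro card_mono) auto
  also have "\<dots> \<le> s" using card_image_le[of "{..<s}" "\<lambda>b. b * m + fst (\<tau> b)"] by simp
  finally show ?thesis .
qed

lemma sparse_rate_pos:
  assumes "n \<ge> 1" "s \<ge> 1" "s \<le> p"
  shows "sparse_rate n p s > 0"
proof -
  have "1 \<le> real p / real s" using assms by simp
  then have "exp 1 * 1 \<le> exp 1 * (real p / real s)" by (intro mult_left_mono) auto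
  then have "ln (exp 1) \<le> ln (exp 1 * real p / real s)"
    using assms by (subst ln_le_cancel_iff) auto
  then have "0 < ln (exp 1 * real p / real s)" unfolding ln_exp by linarith
  then show ?thesis
    unfolding sparse_rate_def using assms
    by (intro divide_pos_pos mult_pos_pos) (assumption | simp)+
qed

text \<open>
The integral factorises over the \<open>n\<close> independent observations, which turns the one-observation bound into
\<open>exp (n \<theta>\<^sup>2 \<langle>v, w\<rangle>\<^sup>2) = exp (\<gamma> G\<^sup>2)\<close>, where \<open>G\<close> is the total agreement and \<open>\<gamma> = n \<theta>\<^sup>2 / s\<^sup>2\<close>. The rate is
designed so that \<open>\<gamma> s\<close> equals \<open>ln (e p / s) / 48\<close>, and \<open>p / s \<le> 2 m\<close> because \<open>m\<close> is the integer part of \<open>p / s \<ge> 1\<close>.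
\<close>

lemma sparse_second_moment:
  assumes n: "n \<ge> 1" and s: "s \<ge> 1" "s \<le> p" and a: "a > 0" and \<epsilon>: "0 \<le> \<epsilon>" "\<epsilon> \<le> 1"
    and \<theta>: "\<theta> > 0" "\<theta>\<^sup>2 = sparse_rate n p s / 48" "\<theta>\<^sup>2 \<le> 1 / 2"
    and \<tau>: "\<tau> \<in> block_choices s (p div s)"
  defines "m \<equiv> p div s"
  defines "h \<equiv> \<lambda>\<tau> x. ennreal (1 - \<epsilon>) * spike_likelihood p a \<theta> (block_spike s m \<tau>) x + ennreal \<epsilon>"
  shows "(\<Sum>\<tau>'\<in>block_choices s m. (\<integral>\<^sup>+X. (\<Prod>k<n. h \<tau> (X k)) * (\<Prod>k<n. h \<tau>' (X k))
      \<partial>PiM {..<n} (\<lambda>_. white_noise p a))) \<le> ennreal (2 * real (card (block_choices s m)))"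
proof -
  let ?V = "block_choices s m" and ?P = "white_noise p a"
  let ?G = "\<lambda>\<tau>'. \<Sum>b<s. agreement (\<tau> b) (\<tau>' b)"
  have m: "m \<ge> 1" "s * m \<le> p" using s by (auto simp: m_def div_greater_zero_iff Suc_le_eq)
  interpret P: prob_space ?P by (rule prob_space_white_noise)
  interpret PP: product_sigma_finite "\<lambda>_::nat. ?P" ..
  have h_meas: "h \<tau> \<in> borel_measurable ?P" for \<tau>
    unfolding h_def
    by (intro borel_measurable_add borel_measurable_times)
       (auto simp: measurable_cong_sets[OF sets_white_noise refl])
  define \<gamma> where "\<gamma> = real n * \<theta>\<^sup>2 / (real s)\<^sup>2"
  have \<gamma>: "0 \<le> \<gamma>" "\<gamma> * real s \<le> ln (2 * exp 1 * real m) / 48"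
  proof -
    show "0 \<le> \<gamma>" by (simp add: \<gamma>_def)
    have "\<gamma> * real s = ln (exp 1 * real p / real s) / 48"
      unfolding \<gamma>_def \<theta>(2) sparse_rate_def using n s by (simp add: power2_eq_square)
    moreover have "ln (exp 1 * real p / real s) \<le> ln (2 * exp 1 * real m)"
    proof -
      have "p < s * Suc m" unfolding m_def using s dividend_less_times_div[of s p] by simp
      also have "\<dots> \<le> s * (2 * m)" using m by (intro mult_left_mono) auto
      finally have "real p \<le> real s * (2 * real m)" by (metis of_nat_mult of_nat_numeral of_nat_le_iff less_imp_le)
      then have "real p / real s \<le> 2 * real m" using s by (simp add: divide_le_eq mult.commute)
      then have "exp 1 * (real p / real s) \<le> exp 1 * (2 * real m)" by (intro mult_left_mono) auto
      then show ?thesis using s m by (subst ln_le_cancel_iff) (auto simp: mult_ac)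
    qed
    ultimately show "\<gamma> * real s \<le> ln (2 * exp 1 * real m) / 48" by simp
  qed
  have "(\<Sum>\<tau>'\<in>?V. (\<integral>\<^sup>+X. (\<Prod>k<n. h \<tau> (X k)) * (\<Prod>k<n. h \<tau>' (X k)) \<partial>PiM {..<n} (\<lambda>_. ?P)))
      \<le> (\<Sum>\<tau>'\<in>?V. ennreal (exp (\<gamma> * (?G \<tau>')\<^sup>2)))"
  proof (rule sum_mono)
    fix \<tau>' assume \<tau>': "\<tau>' \<in> ?V"
    have \<tau>m: "\<tau> \<in> ?V" using \<tau> by (simp add: m_def)
    let ?v = "block_spike s m \<tau>" and ?w = "block_spike s m \<tau>'"
    have "(\<integral>\<^sup>+X. (\<Prod>k<n. h \<tau> (X k)) * (\<Prod>k<n. h \<tau>' (X k)) \<partial>PiM {..<n} (\<lambda>_. ?P)) =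
        (\<integral>\<^sup>+X. (\<Prod>k<n. h \<tau> (X k) * h \<tau>' (X k)) \<partial>PiM {..<n} (\<lambda>_. ?P))"
      by (simp add: prod.distrib)
    also have "\<dots> = (\<Prod>k<n. \<integral>\<^sup>+x. h \<tau> x * h \<tau>' x \<partial>?P)"
      by (intro PP.product_nn_integral_prod borel_measurable_times_ennreal h_meas) auto
    also have "\<dots> = (\<integral>\<^sup>+x. h \<tau> x * h \<tau>' x \<partial>?P) ^ n" by simp
    also have "\<dots> \<le> ennreal (exp (\<theta>\<^sup>2 * (dot {..<p} ?v ?w)\<^sup>2)) ^ n"
      unfolding h_def using block_spike_unit[OF \<tau>m m(1) s(1) m(2)] block_spike_unit[OF \<tau>' m(1) s(1) m(2)]
      by (intro power_mono contaminated_likelihood_product a \<theta> \<epsilon>) auto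
    also have "\<dots> = ennreal (exp (real n * (\<theta>\<^sup>2 * (dot {..<p} ?v ?w)\<^sup>2)))"
      by (simp only: ennreal_power exp_ge_zero exp_of_nat_mult)
    also have "real n * (\<theta>\<^sup>2 * (dot {..<p} ?v ?w)\<^sup>2) = \<gamma> * (?G \<tau>')\<^sup>2"
      unfolding dot_block_spike[OF \<tau>m \<tau>' m(1) s(1) m(2)] \<gamma>_def by (simp add: power_divide)
    finally show "(\<integral>\<^sup>+X. (\<Prod>k<n. h \<tau> (X k)) * (\<Prod>k<n. h \<tau>' (X k)) \<partial>PiM {..<n} (\<lambda>_. ?P))
      \<le> ennreal (exp (\<gamma> * (?G \<tau>')\<^sup>2))" .
  qed
  also have "\<dots> = ennreal (\<Sum>\<tau>'\<in>?V. exp (\<gamma> * (?G \<tau>')\<^sup>2))" by simp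
  also have "\<dots> \<le> ennreal (2 * real (card ?V))"
    using overlap_exp_square_moment[OF _ m(1) \<gamma>] \<tau> by (intro ennreal_leI) (simp add: m_def)
  finally show ?thesis .
qed

section \<open>The two lower bounds and their combination\<close>

definition worst_case_risk :: "nat \<Rightarrow> nat \<Rightarrow> nat \<Rightarrow> real \<Rightarrow> real \<Rightarrow> ((nat \<Rightarrow> nat \<Rightarrow> real) \<Rightarrow> real Matrix.mat) \<Rightarrow> real \<Rightarrow> ennreal" where
  "worst_case_risk n p s M \<epsilon> T t = (SUP \<Sigma>\<in>F_bounded p s M. SUP Q\<in>prob_dists p.
       emeasure (sample_law n p \<epsilon> \<Sigma> Q) {X \<in> space (sample_law n p \<epsilon> \<Sigma> Q). (op_norm (T X - \<Sigma>))\<^sup>2 \<ge> t})"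

lemma sets_sample_law: "sets (sample_law n p \<epsilon> \<Sigma> Q) = sets (sample_space n p)"
  unfolding sample_law_def sample_space_def
  by (intro sets_PiM_cong refl) (simp add: contaminated_def)

text \<open>
Passing from \<open>B\<close> to the full error event uses monotonicity of the measure, and therefore the
measurability of that event.
\<close>

lemma worst_case_risk_ge:
  assumes "\<Sigma> \<in> F_bounded p s M" "Q \<in> prob_dists p" and T: "T \<in> estimators n p"
    and B: "B \<subseteq> {X \<in> space (sample_space n p). (op_norm (T X - \<Sigma>))\<^sup>2 \<ge> t}"
    and c: "c \<le> emeasure (sample_law n p \<epsilon> \<Sigma> Q) B"
  shows "c \<le> worst_case_risk n p s M \<epsilon> T t"
proof -
  let ?E = "{X \<in> space (sample_law n p \<epsilon> \<Sigma> Q). (op_norm (T X - \<Sigma>))\<^sup>2 \<ge> t}"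
  have sp: "space (sample_law n p \<epsilon> \<Sigma> Q) = space (sample_space n p)"
    by (rule sets_eq_imp_space_eq[OF sets_sample_law])
  have "\<Sigma> \<in> carrier_mat p p" using assms(1) by (simp add: F_bounded_def F_sparse_def psd_mats_def)
  from op_norm_estimation_error_measurable[OF T this]
  have "{X \<in> space (sample_space n p). (op_norm (T X - \<Sigma>))\<^sup>2 \<ge> t} \<in> sets (sample_space n p)"
    by measurable
  then have "?E \<in> sets (sample_law n p \<epsilon> \<Sigma> Q)" by (simp add: sets_sample_law sp)
  then have "emeasure (sample_law n p \<epsilon> \<Sigma> Q) B \<le> emeasure (sample_law n p \<epsilon> \<Sigma> Q) ?E"
    using B by (intro emeasure_mono) (auto simp: sp)
  with c have "c \<le> emeasure (sample_law n p \<epsilon> \<Sigma> Q) ?E" by (rule order_trans)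
  then show ?thesis unfolding worst_case_risk_def
    using assms(1,2) by (intro SUP_upper2[of \<Sigma>] SUP_upper2[of Q]) auto
qed

lemma two_balls:
  assumes v: "dot {..<p} v v = 1" and T: "T \<in> carrier_mat p p"
    and small: "(op_norm (T - spiked p a 0 v))\<^sup>2 < t" and t: "4 * t \<le> (a * \<theta>)\<^sup>2" and a: "a \<ge> 0"
  shows "t \<le> (op_norm (T - spiked p a \<theta> v))\<^sup>2"
proof (rule ccontr)
  let ?x = "op_norm (T - spiked p a 0 v)" and ?y = "op_norm (T - spiked p a \<theta> v)"
  assume "\<not> ?thesis"
  then have y: "?y\<^sup>2 < t" by simp
  have "t > 0" using small by (rule le_less_trans[rotated]) simp
  have "?x < sqrt t" "?y < sqrt t" using small y by (auto intro!: real_less_rsqrt)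
  then have "a * \<bar>\<theta>\<bar> < 2 * sqrt t" using op_norm_spike_separation[OF v T, of a \<theta>] by simp
  then have "(a * \<bar>\<theta>\<bar>)\<^sup>2 < (2 * sqrt t)\<^sup>2" using a by (intro power_strict_mono) auto
  then show False using t \<open>t > 0\<close> by (simp add: power_mult_distrib)
qed

text \<open>
With \<open>a = M / 2\<close> and \<open>\<theta>\<^sup>2\<close> equal to the rate divided by \<open>48\<close>, the squared half-distance \<open>(a \<theta> / 2)\<^sup>2\<close>
is \<open>M\<^sup>2 / 768\<close> times the rate. The bound on the rate keeps \<open>\<theta> \<le> 1\<close>, so that the largest eigenvalue
\<open>a (1 + \<theta>)\<close> is at most \<open>M\<close>.
\<close>

lemma risk_ge_sparse_rate:
  assumes n: "n \<ge> 1" and s: "s \<ge> 1" "s \<le> p" and M: "M > 0" and \<epsilon>: "0 \<le> \<epsilon>" "\<epsilon> \<le> 1"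
    and rate: "sparse_rate n p s \<le> 1" and T: "T \<in> estimators n p"
  shows "ennreal (1 / 4) \<le> worst_case_risk n p s M \<epsilon> T (M\<^sup>2 / 768 * sparse_rate n p s)"
proof -
  define m where "m = p div s"
  define a where "a = M / 2"
  define \<theta> where "\<theta> = sqrt (sparse_rate n p s / 48)"
  let ?P = "white_noise p a" and ?V = "block_choices s m"
  let ?PP = "PiM {..<n} (\<lambda>_. ?P)"
  let ?t = "M\<^sup>2 / 768 * sparse_rate n p s"
  have m: "m \<ge> 1" "s * m \<le> p" using s by (auto simp: m_def div_greater_zero_iff Suc_le_eq)
  have a: "a > 0" using M by (simp add: a_def)
  have rpos: "sparse_rate n p s > 0" using n s by (rule sparse_rate_pos)
  have \<theta>: "\<theta> > 0" "\<theta>\<^sup>2 = sparse_rate n p s / 48" "\<theta>\<^sup>2 \<le> 1 / 2" "\<theta> \<le> 1"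
    using rpos rate by (auto simp: \<theta>_def)
  have t: "4 * ?t \<le> (a * \<theta>)\<^sup>2"
    unfolding power_mult_distrib \<theta>(2) a_def by (simp add: power_divide)
  define v where "v = block_spike s m"
  have vv: "dot {..<p} (v \<tau>) (v \<tau>) = 1" if "\<tau> \<in> ?V" for \<tau>
    unfolding v_def using that m s by (intro block_spike_unit)
  have F: "spiked p a \<eta> (v \<tau>) \<in> F_bounded p s M" if "\<tau> \<in> ?V" "0 \<le> \<eta>" "\<eta> \<le> 1" for \<tau> \<eta>
  proof (rule spiked_in_F_bounded[OF vv[OF that(1)]])
    show "card {i. i < p \<and> v \<tau> i \<noteq> 0} \<le> s" unfolding v_def by (rule card_support_block_spike[OF m(1)])
    have "a * (1 + \<eta>) \<le> a * 2" using a that by (intro mult_left_mono) auto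
    then show "a * (1 + \<eta>) \<le> M" by (simp add: a_def)
  qed (use a that M in \<open>auto simp: a_def\<close>)
  define h where "h = (\<lambda>\<tau> x. ennreal (1 - \<epsilon>) * spike_likelihood p a \<theta> (v \<tau>) x + ennreal \<epsilon>)"
  interpret P: prob_space ?P by (rule prob_space_white_noise)
  have [measurable]: "spike_likelihood p a \<theta> u \<in> borel_measurable ?P" for u
    by (simp add: measurable_cong_sets[OF sets_white_noise refl])
  have h [measurable]: "h \<tau> \<in> borel_measurable ?P" for \<tau> unfolding h_def by measurable
  have h1: "(\<integral>\<^sup>+x. h \<tau> x \<partial>?P) = 1" if "\<tau> \<in> ?V" for \<tau>
  proof -
    have "(\<integral>\<^sup>+x. h \<tau> x \<partial>?P) = ennreal (1 - \<epsilon>) * 1 + ennreal \<epsilon> * 1"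
      unfolding h_def using nn_integral_spike_likelihood[OF vv[OF that] a, of \<theta>] \<theta> P.emeasure_space_1
      by (subst nn_integral_add) (auto simp: nn_integral_cmult)
    also have "\<dots> = 1" using \<epsilon> by (simp flip: ennreal_plus)
    finally show ?thesis .
  qed
  have law: "sample_law n p \<epsilon> (spiked p a \<theta> (v \<tau>)) ?P = density ?PP (\<lambda>X. \<Prod>k<n. h \<tau> (X k))"
    if "\<tau> \<in> ?V" for \<tau>
  proof -
    have "contaminated p \<epsilon> (spiked p a \<theta> (v \<tau>)) ?P = density ?P (h \<tau>)"
      unfolding h_def using \<theta> by (intro contaminated_spiked_density vv that a) simp
    then show ?thesis
      using PiM_density_iid[OF _ prob_space_white_noise h h1[OF that], of "{..<n}"]
      by (simp add: sample_law_def)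
  qed
  have sets_PP: "sets ?PP = sets (sample_space n p)"
    unfolding sample_space_def by (intro sets_PiM_cong refl) (simp add: sets_white_noise)
  have space_PP: "space ?PP = space (sample_space n p)"
    by (rule sets_eq_imp_space_eq[OF sets_PP])
  have Vne: "?V \<noteq> {}"
    using card_block_choices[of s m] m by (metis card.empty mult_is_0 not_one_le_zero power_not_zero zero_neq_numeral)
  then obtain \<tau>0 where \<tau>0: "\<tau>0 \<in> ?V" by blast
  let ?I = "spiked p a 0 (v \<tau>0)"
  define A where "A = {X \<in> space (sample_space n p). (op_norm (T X - ?I))\<^sup>2 \<ge> ?t}"
  have A: "A \<in> sets ?PP"
    unfolding A_def sets_PP
    using op_norm_estimation_error_measurable[OF T spiked_carrier(1)[of p a 0 "v \<tau>0"]] by measurable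
  have "ennreal (1 / 4) \<le> emeasure ?PP A \<or>
      (\<exists>\<tau>\<in>?V. ennreal (1 / 4) \<le> emeasure (density ?PP (\<lambda>X. \<Prod>k<n. h \<tau> (X k))) (space ?PP - A))"
  proof (rule second_moment_bound[OF prob_space_PiM[OF prob_space_white_noise] finite_block_choices Vne _ _ _ A])
    fix \<tau> assume \<tau>: "\<tau> \<in> ?V"
    show "(\<lambda>X. \<Prod>k<n. h \<tau> (X k)) \<in> borel_measurable ?PP"
      by (intro borel_measurable_prod_ennreal) measurable
    interpret PP: product_sigma_finite "\<lambda>_::nat. ?P" ..
    show "(\<integral>\<^sup>+X. (\<Prod>k<n. h \<tau> (X k)) \<partial>?PP) = 1"
      using PP.product_nn_integral_prod[of "{..<n}" "\<lambda>_. h \<tau>"] h h1[OF \<tau>] by simp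
    show "(\<Sum>\<tau>'\<in>?V. \<integral>\<^sup>+X. (\<Prod>k<n. h \<tau> (X k)) * (\<Prod>k<n. h \<tau>' (X k)) \<partial>?PP) \<le> ennreal (2 * real (card ?V))"
      using sparse_second_moment[OF n s a \<epsilon> \<theta>(1,2,3), of \<tau>] \<tau> by (simp add: h_def v_def m_def)
  qed
  then show ?thesis
  proof (elim disjE bexE)
    assume "ennreal (1 / 4) \<le> emeasure ?PP A"
    then show ?thesis
      using contaminated_by_itself[OF vv[OF \<tau>0] less_imp_le[OF a] \<epsilon>]
      by (intro worst_case_risk_ge[OF F[OF \<tau>0] white_noise_prob_dists[of p a] T, of 0 A])
         (auto simp: sample_law_def A_def)
  next
    fix \<tau> assume \<tau>: "\<tau> \<in> ?V" and
      le: "ennreal (1 / 4) \<le> emeasure (density ?PP (\<lambda>X. \<Prod>k<n. h \<tau> (X k))) (space ?PP - A)"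
    show ?thesis
    proof (rule worst_case_risk_ge[OF F[OF \<tau>] white_noise_prob_dists T])
      show "0 \<le> \<theta>" "\<theta> \<le> 1" using \<theta> by auto
      show "ennreal (1 / 4) \<le> emeasure (sample_law n p \<epsilon> (spiked p a \<theta> (v \<tau>)) ?P) (space ?PP - A)"
        unfolding law[OF \<tau>] by (rule le)
      show "space ?PP - A \<subseteq> {X \<in> space (sample_space n p). ?t \<le> (op_norm (T X - spiked p a \<theta> (v \<tau>)))\<^sup>2}"
      proof clarify
        fix X assume X: "X \<in> space ?PP" "X \<notin> A"
        then have "X \<in> space (sample_space n p)" by (simp add: space_PP)
        moreover have "T X \<in> carrier_mat p p" using T calculation by (simp add: estimators_def)
        moreover have "(op_norm (T X - spiked p a 0 (v \<tau>)))\<^sup>2 < ?t"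
          using X spiked_0[of p a "v \<tau>0" "v \<tau>"] by (simp add: A_def space_PP)
        ultimately show "X \<in> space (sample_space n p) \<and> ?t \<le> (op_norm (T X - spiked p a \<theta> (v \<tau>)))\<^sup>2"
          using two_balls[OF vv[OF \<tau>] _ _ t] a by simp
      qed
    qed
  qed
qed

text \<open>
Under both covariances the sample has the same law, so the event that the estimator misses \<open>a I\<close> and
its complement, on which it misses the shrunk covariance, have probabilities that add up to one.
\<close>

lemma risk_ge_contamination_rate:
  assumes p: "p \<ge> 1" and s: "s \<ge> 1" and M: "M > 0" and \<epsilon>: "0 < \<epsilon>" "\<epsilon> \<le> 1"
    and T: "T \<in> estimators n p"
  shows "ennreal (1 / 4) \<le> worst_case_risk n p s M \<epsilon> T (M\<^sup>2 / 768 * \<epsilon>\<^sup>2)"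
proof -
  define a where "a = M / 2"
  define \<theta> where "\<theta> = (1 - \<epsilon> / 2)\<^sup>2 - 1"
  define v where "v = (\<lambda>i :: nat. if i = 0 then 1 else 0 :: real)"
  let ?P = "white_noise p a"
  let ?PP = "PiM {..<n} (\<lambda>_. ?P)"
  let ?t = "M\<^sup>2 / 768 * \<epsilon>\<^sup>2"
  have a: "a > 0" using M by (simp add: a_def)
  have vv: "dot {..<p} v v = 1"
    using p by (simp add: dot_def v_def if_distrib[of "\<lambda>x. x * _"] cong: if_cong)
  have \<theta>: "- 1 \<le> \<theta>" "\<theta> \<le> 0" using \<epsilon> by (auto simp: \<theta>_def power_le_one)
  have t: "4 * ?t \<le> (a * \<theta>)\<^sup>2"
  proof -
    have "- \<theta> = \<epsilon> * (1 - \<epsilon> / 4)" by (simp add: \<theta>_def power2_eq_square field_simps)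
    moreover have "\<epsilon> * (1 / 2) \<le> \<epsilon> * (1 - \<epsilon> / 4)" using \<epsilon> by (intro mult_left_mono) auto
    ultimately have "(\<epsilon> / 2)\<^sup>2 \<le> (- \<theta>)\<^sup>2" using \<epsilon> by (intro power_mono) auto
    then have "a\<^sup>2 * (\<epsilon> / 2)\<^sup>2 \<le> a\<^sup>2 * \<theta>\<^sup>2" by (intro mult_left_mono) auto
    then have "M\<^sup>2 * \<epsilon>\<^sup>2 / 16 \<le> (a * \<theta>)\<^sup>2" by (simp add: a_def power_mult_distrib power_divide)
    moreover have "4 * ?t \<le> M\<^sup>2 * \<epsilon>\<^sup>2 / 16" by simp
    ultimately show ?thesis by (rule order_trans[rotated])
  qed
  have F: "spiked p a \<eta> v \<in> F_bounded p s M" if "- 1 \<le> \<eta>" "\<eta> \<le> 0" for \<eta>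
  proof (rule spiked_in_F_bounded[OF vv])
    have "card {i. i < p \<and> v i \<noteq> 0} \<le> card {0 :: nat}" by (intro card_mono) (auto simp: v_def split: if_splits)
    then show "card {i. i < p \<and> v i \<noteq> 0} \<le> s" using s by simp
    have "a * (1 + \<eta>) \<le> a * 1" using a that by (intro mult_left_mono) auto
    then show "a * (1 + \<eta>) \<le> M" using M by (simp add: a_def)
  qed (use a that M in \<open>auto simp: a_def\<close>)
  obtain Q where Q: "Q \<in> prob_dists p" "contaminated p \<epsilon> (spiked p a \<theta> v) Q = ?P"
    using contamination_hides_shrinkage[OF vv a \<epsilon>] unfolding \<theta>_def by blast
  have law: "sample_law n p \<epsilon> (spiked p a \<theta> v) Q = ?PP" "sample_law n p \<epsilon> (spiked p a 0 v) ?P = ?PP"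
    using Q contaminated_by_itself[OF vv less_imp_le[OF a]] \<epsilon> by (simp_all add: sample_law_def)
  interpret PP: prob_space ?PP by (rule prob_space_PiM) (rule prob_space_white_noise)
  have sets_PP: "sets ?PP = sets (sample_space n p)"
    using sets_sample_law[of n p \<epsilon> "spiked p a \<theta> v" Q] law by simp
  have space_PP: "space ?PP = space (sample_space n p)" by (rule sets_eq_imp_space_eq[OF sets_PP])
  define A where "A = {X \<in> space (sample_space n p). (op_norm (T X - spiked p a 0 v))\<^sup>2 \<ge> ?t}"
  have A: "A \<in> sets ?PP"
    unfolding A_def sets_PP
    using op_norm_estimation_error_measurable[OF T spiked_carrier(1)[of p a 0 v]] by measurable
  have "PP.prob (space ?PP - A) = 1 - PP.prob A" using A by (rule PP.prob_compl)
  then consider "1 / 4 \<le> PP.prob A" | "1 / 4 \<le> PP.prob (space ?PP - A)" by linarith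
  then show ?thesis
  proof cases
    case 1
    then have "ennreal (1 / 4) \<le> emeasure ?PP A" by (simp add: PP.emeasure_eq_measure ennreal_leI)
    then show ?thesis
      by (intro worst_case_risk_ge[OF F white_noise_prob_dists[of p a] T, of 0 A]) (auto simp: law A_def)
  next
    case 2
    show ?thesis
    proof (rule worst_case_risk_ge[OF F[OF \<theta>] Q(1) T])
      show "ennreal (1 / 4) \<le> emeasure (sample_law n p \<epsilon> (spiked p a \<theta> v) Q) (space ?PP - A)"
        unfolding law using 2 by (simp add: PP.emeasure_eq_measure ennreal_leI)
      show "space ?PP - A \<subseteq> {X \<in> space (sample_space n p). ?t \<le> (op_norm (T X - spiked p a \<theta> v))\<^sup>2}"
      proof
        fix X assume X: "X \<in> space ?PP - A"
        then have X': "X \<in> space (sample_space n p)" by (simp add: space_PP)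
        then have "T X \<in> carrier_mat p p" using T by (simp add: estimators_def)
        moreover have "(op_norm (T X - spiked p a 0 v))\<^sup>2 < ?t"
          using X X' by (simp add: A_def)
        ultimately show "X \<in> {X \<in> space (sample_space n p). ?t \<le> (op_norm (T X - spiked p a \<theta> v))\<^sup>2}"
          using two_balls[OF vv _ _ t] a X' by simp
      qed
    qed
  qed
qed

theorem theorem3p7:
  fixes M :: real
  assumes "M > 0"
  shows "\<exists>C>0. \<exists>C\<^sub>1>0. \<exists>c>0. \<forall>n p s :: nat. \<forall>\<epsilon> :: real.
    n \<ge> 1 \<longrightarrow> p \<ge> 1 \<longrightarrow> s \<ge> 1 \<longrightarrow> s \<le> p \<longrightarrow> sparse_rate n p s \<le> C\<^sub>1 \<longrightarrow> 0 \<le> \<epsilon> \<longrightarrow> \<epsilon> \<le> 1 \<longrightarrow>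
    (INF T\<in>estimators n p. SUP \<Sigma>\<in>F_bounded p s M. SUP Q\<in>prob_dists p.
       emeasure (sample_law n p \<epsilon> \<Sigma> Q)
         {X \<in> space (sample_law n p \<epsilon> \<Sigma> Q).
            (op_norm (T X - \<Sigma>))\<^sup>2 \<ge> C * max (sparse_rate n p s) (\<epsilon>\<^sup>2)})
    \<ge> ennreal c"
proof -
  let ?C = "M\<^sup>2 / 768"
  have main: "ennreal (1 / 4) \<le> worst_case_risk n p s M \<epsilon> T (?C * max (sparse_rate n p s) (\<epsilon>\<^sup>2))"
    if "n \<ge> 1" "p \<ge> 1" "s \<ge> 1" "s \<le> p" "sparse_rate n p s \<le> 1" "0 \<le> \<epsilon>" "\<epsilon> \<le> 1" "T \<in> estimators n p"
    for n p s \<epsilon> T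
  proof (cases "\<epsilon>\<^sup>2 \<le> sparse_rate n p s")
    case True
    then show ?thesis using risk_ge_sparse_rate[of n s p M \<epsilon> T] that assms by (simp add: max_def)
  next
    case False
    have "0 < sparse_rate n p s" using that by (intro sparse_rate_pos)
    with False have "\<epsilon> \<noteq> 0" by auto
    then have "ennreal (1 / 4) \<le> worst_case_risk n p s M \<epsilon> T (M\<^sup>2 / 768 * \<epsilon>\<^sup>2)"
      using that assms by (intro risk_ge_contamination_rate) auto
    then show ?thesis using False by (simp add: max_def)
  qed
  show ?thesis
  proof (rule exI[of _ ?C], rule conjI, use assms in simp, rule exI[of _ 1], rule conjI, simp,
      rule exI[of _ "1 / 4"], rule conjI, simp, intro allI impI)
    fix n p s :: nat and \<epsilon> :: real
    assume "1 \<le> n" "1 \<le> p" "1 \<le> s" "s \<le> p" "sparse_rate n p s \<le> 1" "0 \<le> \<epsilon>" "\<epsilon> \<le> 1"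
    then show "ennreal (1 / 4) \<le> (INF T\<in>estimators n p. SUP \<Sigma>\<in>F_bounded p s M. SUP Q\<in>prob_dists p.
       emeasure (sample_law n p \<epsilon> \<Sigma> Q)
         {X \<in> space (sample_law n p \<epsilon> \<Sigma> Q).
            (op_norm (T X - \<Sigma>))\<^sup>2 \<ge> ?C * max (sparse_rate n p s) (\<epsilon>\<^sup>2)})"
      using main unfolding worst_case_risk_def by (intro INF_greatest)
  qed
qed

end
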